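(* Suppose there is a square $S_0\subseteq S$ with a constant side length $s_0>0$ (not depending on $n$) such that $h(u,v)=d(u,v)$ whenever $u\in S_0$ or $v\in S_0$. For every edge weight exponent $0<\alpha<1$ there is a positive constant $D_2$ such that $$\mathrm{var}(TSP_n)\ge D_2 n^{1-\alpha}$$ for all $n$ large.
   Context: Let $S=[-\frac12,\frac12]^2$ be the unit square and $f$ a probability density on $S$ with $\epsilon_1\le \inf_{S} f\le \sup_{S} f\le \epsilon_2$ for constants $0<\epsilon_1\le\epsilon_2<\infty$. Let $X_1,X_2,\ldots$ be i.i.d. with density $f$. Let $d$ be Euclidean distance and $h:S\times S\to[0,\infty)$ a deterministic measurable function with $c_1 d(x,y)\le h(x,y)=h(y,x)\le c_2 d(x,y)$ for all $x,y\in S$, where $c_1,c_2>0$ are constants ($h$ need not be a metric). Let $K_n$ be the complete graph on the nodes $X_1,\ldots,X_n$; the edge $e=(X_i,X_j)$ has weight $h^\alpha(e)=h(X_i,X_j)^\alpha$. The weight of a cycle $\mathcal{C}$ is $W(\mathcal{C})=\sum_{e\in\mathcal{C}}h^\alpha(e)$, and $TSP_n$ is the minimum of $W(\mathcal{C})$ over all spanning (Hamiltonian) cycles $\mathcal{C}$ of $K_n$. All constants are independent of $n$. *)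

theory Defs
  imports "HOL-Probability.Probability"
begin

definition unit_square :: "(real^2) set" where
  "unit_square = cbox (\<chi> i. - 1/2) (\<chi> i. 1/2)"

text \<open>Closed squares of side length \<open>s\<close>; the sides, spanned by the orthonormal frame
  \<open>u\<close>, \<open>v\<close>, need not be parallel to the coordinate axes.\<close>

definition is_square :: "(real^2) set \<Rightarrow> real \<Rightarrow> bool" where
  "is_square T s \<longleftrightarrow> 0 < s \<and>
     (\<exists>a u v. norm u = 1 \<and> norm v = 1 \<and> u \<bullet> v = 0 \<and>
        T = {a + x *\<^sub>R u + y *\<^sub>R v |x y. x \<in> {0..s} \<and> y \<in> {0..s}})"

text \<open>A spanning cycle of the complete graph on the nodes \<open>1, \<dots>, n\<close> is given by the list of nodes
  in the order of a traversal, so each cycle is represented by all of its \<open>2 n\<close> traversals.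
  For \<open>n < 3\<close> there is none, and then \<open>TSP\<close> below is an unspecified constant.\<close>

definition spanning_cycles :: "nat \<Rightarrow> nat list set" where
  "spanning_cycles n = {vs. distinct vs \<and> set vs = {1..n} \<and> 3 \<le> length vs}"

definition cycle_edges :: "nat list \<Rightarrow> (nat \<times> nat) list" where
  "cycle_edges vs = zip vs (rotate1 vs)"

text \<open>Here \<open>p i\<close> is the position of node \<open>i\<close>. The edges of a cycle come with the orientation
  of the traversal, which is irrelevant for symmetric \<open>h\<close>.\<close>

definition cycle_weight ::
  "(real^2 \<Rightarrow> real^2 \<Rightarrow> real) \<Rightarrow> real \<Rightarrow> (nat \<Rightarrow> real^2) \<Rightarrow> nat list \<Rightarrow> real" where
  "cycle_weight h \<alpha> p vs = (\<Sum>(i, j)\<leftarrow>cycle_edges vs. h (p i) (p j) powr \<alpha>)"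

definition TSP ::
  "(real^2 \<Rightarrow> real^2 \<Rightarrow> real) \<Rightarrow> real \<Rightarrow> (nat \<Rightarrow> real^2) \<Rightarrow> nat \<Rightarrow> real" where
  "TSP h \<alpha> p n = Min (cycle_weight h \<alpha> p ` spanning_cycles n)"

end

theory Submission
  imports Defs
begin

text \<open>
  For \<open>\<alpha> < 1\<close> the function \<open>t \<mapsto> t\<^sup>\<alpha>\<close> is strictly subadditive. Hence a site at distance at least
  \<open>r\<close> from all other sites adds at least \<open>(2 - 2\<^sup>\<alpha>) r\<^sup>\<alpha>\<close> to the optimal tour, while a site at distance
  less than \<open>\<delta>\<close> from some other site adds at most \<open>2 \<delta>\<^sup>\<alpha>\<close>, wherever the other sites are. Take
  \<open>r = r\<^sub>0 n\<^sup>-\<^sup>1\<^sup>/\<^sup>2\<close> and \<open>\<delta> = \<kappa> r\<close> with \<open>\<kappa>\<close> small: moving one site from an isolated place to a place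
  next to another site then lowers the minimum by an amount of order \<open>n\<^sup>-\<^sup>\<alpha>\<^sup>/\<^sup>2\<close>. Both kinds of place have
  probability bounded below, so of order \<open>n\<close> sites each contribute a fluctuation of this size, which
  accounts for a variance of order \<open>n \<cdot> n\<^sup>-\<^sup>\<alpha>\<close>.

  The independence behind this count is made exact by a swapping argument. Split the sites into
  movers \<open>i \<le> n div 2\<close> and anchors, and give each mover \<open>i\<close> an independent copy \<open>n + i\<close>. Let
  \<open>M\<^sub>i\<close> be the event that mover and copy lie in a fixed disc and the copy is near an anchor, and let
  the score of \<open>i\<close> be the indicator of \<open>M\<^sub>i\<close> minus the indicator of the image of \<open>M\<^sub>i\<close> under the exchange
  of \<open>i\<close> and its copy. This exchange preserves the joint law, negates the score of \<open>i\<close> and fixes all other scores.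
  Scores are therefore pairwise orthogonal, their sum \<open>G\<close> has second moment at most \<open>n div 2\<close>, and the
  covariance of \<open>TSP\<close> with \<open>G\<close> is the expected sum, over the movers for which \<open>M\<^sub>i\<close> holds, of the
  decrease of \<open>TSP\<close> caused by moving \<open>i\<close> to its copy. By the above it is of order \<open>n\<^sup>1\<^sup>-\<^sup>\<alpha>\<^sup>/\<^sup>2\<close>, and Cauchy--Schwarz
  (\<open>variance_lower_bound\<close>) gives a variance of order \<open>(n\<^sup>1\<^sup>-\<^sup>\<alpha>\<^sup>/\<^sup>2)\<^sup>2 / n\<close>.

  One difficulty remains: \<open>h\<close> agrees with the distance only if one of its arguments lies in the given
  square. If both tour neighbours of a mover lie outside, there is no triangle inequality for
  closing the gap that the mover leaves, and a bounded loss can occur. But such a mover has a tour edge of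
  macroscopic length, and an optimal tour has only boundedly many of those
  (\<open>card_long_edges_optimal_tour\<close>): two long edges with almost equal initial points and almost equal
  end points could be replaced by two short ones. The total loss is thus bounded and negligible
  against \<open>n\<^sup>1\<^sup>-\<^sup>\<alpha>\<^sup>/\<^sup>2\<close>.
\<close>

section \<open>Concavity of powers with exponent below one\<close>

text \<open>
  By concavity of \<open>t \<mapsto> t\<^sup>\<alpha>\<close>, the derivative of \<open>(t + s)\<^sup>\<alpha> - t\<^sup>\<alpha>\<close> with respect to \<open>t\<close> is not positive.
\<close>
lemma powr_increment_antimono:
  fixes r x s \<alpha> :: real
  assumes "0 < r" "r \<le> x" "0 \<le> s" "0 < \<alpha>" "\<alpha> < 1"
  shows "(x + s) powr \<alpha> - x powr \<alpha> \<le> (r + s) powr \<alpha> - r powr \<alpha>"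
proof (rule DERIV_nonpos_imp_nonincreasing[OF assms(2)])
  fix t assume t: "r \<le> t" "t \<le> x"
  then have "0 < t" using assms by simp
  then have "((\<lambda>t. (t + s) powr \<alpha> - t powr \<alpha>) has_real_derivative
      \<alpha> * (t + s) powr (\<alpha> - 1) - \<alpha> * t powr (\<alpha> - 1)) (at t)"
    using assms by (auto intro!: derivative_eq_intros)
  moreover have "(t + s) powr (\<alpha> - 1) \<le> t powr (\<alpha> - 1)"
    using \<open>0 < t\<close> assms by (intro powr_mono2') auto
  ultimately show "\<exists>y. ((\<lambda>t. (t + s) powr \<alpha> - t powr \<alpha>) has_real_derivative y) (at t) \<and> y \<le> 0"
    using assms by (intro exI[of _ "\<alpha> * (t + s) powr (\<alpha> - 1) - \<alpha> * t powr (\<alpha> - 1)"]) auto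
qed

text \<open>
  The defect of additivity grows with each argument, so it is smallest at \<open>x = y = r\<close>. This is the
  cost of an isolated site, and the only place where \<open>\<alpha> < 1\<close> gives more than a triangle inequality.
\<close>
lemma powr_strict_subadditive:
  fixes r x y \<alpha> :: real
  assumes "0 < r" "r \<le> x" "r \<le> y" "0 < \<alpha>" "\<alpha> < 1"
  shows "(2 - 2 powr \<alpha>) * r powr \<alpha> \<le> x powr \<alpha> + y powr \<alpha> - (x + y) powr \<alpha>"
proof -
  have "(x + y) powr \<alpha> - x powr \<alpha> \<le> (r + y) powr \<alpha> - r powr \<alpha>"
    by (rule powr_increment_antimono) (use assms in auto)
  moreover have "(y + r) powr \<alpha> - y powr \<alpha> \<le> (r + r) powr \<alpha> - r powr \<alpha>"
    by (rule powr_increment_antimono) (use assms in auto)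
  moreover have "(r + r) powr \<alpha> = 2 powr \<alpha> * r powr \<alpha>"
    using assms powr_mult[of 2 r \<alpha>] by simp
  ultimately show ?thesis by (simp add: algebra_simps)
qed

lemma two_powr_less_two: "(\<alpha>::real) < 1 \<Longrightarrow> 2 powr \<alpha> < 2"
  using powr_less_mono[of \<alpha> 1 2] by simp

lemma powr_subadditive:
  fixes x y \<alpha> :: real
  assumes "0 \<le> x" "0 \<le> y" "0 < \<alpha>" "\<alpha> < 1"
  shows "(x + y) powr \<alpha> \<le> x powr \<alpha> + y powr \<alpha>"
proof (cases "x = 0 \<or> y = 0")
  case False
  then have "0 \<le> (2 - 2 powr \<alpha>) * min x y powr \<alpha>"
    using two_powr_less_two[of \<alpha>] assms by (intro mult_nonneg_nonneg) auto
  with powr_strict_subadditive[of "min x y" x y \<alpha>] False assms show ?thesis by auto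
qed (use assms in auto)

section \<open>Surgery on closed tours\<close>

definition tour_weight :: "('b \<Rightarrow> 'b \<Rightarrow> real) \<Rightarrow> 'b list \<Rightarrow> real" where
  "tour_weight g vs = (\<Sum>(i, j)\<leftarrow>zip vs (rotate1 vs). g i j)"

fun path_weight :: "('b \<Rightarrow> 'b \<Rightarrow> real) \<Rightarrow> 'b list \<Rightarrow> real" where
  "path_weight g (x # y # zs) = g x y + path_weight g (y # zs)"
| "path_weight g xs = 0"

lemma cycle_weight_eq_tour_weight:
  "cycle_weight h \<alpha> p vs = tour_weight (\<lambda>i j. h (p i) (p j) powr \<alpha>) vs"
  by (simp add: cycle_weight_def cycle_edges_def tour_weight_def)

lemma tour_weight_Cons_path:
  "tour_weight g (x # xs) = path_weight g (x # xs) + g (last (x # xs)) x"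
proof -
  have "(\<Sum>(i, j)\<leftarrow>zip (x # xs) (xs @ [z]). g i j) = path_weight g (x # xs) + g (last (x # xs)) z" for z
    by (induction xs arbitrary: x) auto
  then show ?thesis by (simp add: tour_weight_def)
qed

lemma path_weight_append:
  assumes "xs \<noteq> []" "ys \<noteq> []"
  shows "path_weight g (xs @ ys) = path_weight g xs + g (last xs) (hd ys) + path_weight g ys"
  using assms
proof (induction xs)
  case (Cons x xs)
  then show ?case by (cases xs; cases ys) auto
qed simp

text \<open>
  Symmetry is demanded on the nodes of the path only, because a weight coming from \<open>h\<close> is symmetric
  only for positions in the unit square.
\<close>
lemma path_weight_rev:
  assumes "\<And>i j. i \<in> set xs \<Longrightarrow> j \<in> set xs \<Longrightarrow> g i j = g j i"
  shows "path_weight g (rev xs) = path_weight g xs"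
  using assms
proof (induction xs)
  case (Cons x xs)
  show ?case
  proof (cases xs)
    case (Cons y ys)
    have "path_weight g (rev (x # xs)) = path_weight g (rev xs) + g y x"
      using path_weight_append[of "rev xs" "[x]" g] Cons by simp
    also have "\<dots> = path_weight g xs + g x y"
      using Cons.IH Cons.prems Cons by (metis list.set_intros(1) list.set_intros(2))
    finally show ?thesis using Cons by simp
  qed simp
qed simp

lemma tour_weight_append:
  assumes "xs \<noteq> []" "ys \<noteq> []"
  shows "tour_weight g (xs @ ys) =
    path_weight g xs + g (last xs) (hd ys) + path_weight g ys + g (last ys) (hd xs)"
proof -
  obtain x xs' where x: "xs = x # xs'" using assms by (cases xs) auto
  have "tour_weight g (xs @ ys) = path_weight g (xs @ ys) + g (last (xs @ ys)) (hd xs)"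
    using tour_weight_Cons_path[of g x "xs' @ ys"] x by simp
  then show ?thesis using path_weight_append[OF assms, of g] assms by simp
qed

lemma tour_weight_rotate: "tour_weight g (xs @ ys) = tour_weight g (ys @ xs)"
  by (cases "xs = [] \<or> ys = []") (auto simp: tour_weight_append)

text \<open>
  Read from right to left this also removes a node. Since tours can be rotated, every node can be
  brought to the front.
\<close>
lemma tour_weight_insert:
  assumes "xs \<noteq> []"
  shows "tour_weight g (v # xs) =
    tour_weight g xs + g v (hd xs) + g (last xs) v - g (last xs) (hd xs)"
proof -
  obtain x xs' where "xs = x # xs'" using assms by (cases xs) auto
  then show ?thesis
    using tour_weight_append[of "[v]" xs g] tour_weight_Cons_path[of g x xs'] by simp
qed

lemma tour_weight_cong:
  assumes "\<And>i j. i \<in> set vs \<Longrightarrow> j \<in> set vs \<Longrightarrow> g i j = g' i j"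
  shows "tour_weight g vs = tour_weight g' vs"
proof -
  have "g i j = g' i j" if "(i, j) \<in> set (zip vs (rotate1 vs))" for i j
    using set_zip_leftD[OF that] set_zip_rightD[OF that] assms by simp
  then show ?thesis
    unfolding tour_weight_def by (intro arg_cong[of _ _ sum_list] map_cong) auto
qed

text \<open>
  The 2-opt move: reversing one arc of the tour exchanges the two edges at its ends and keeps
  the weight of everything else.
\<close>
lemma tour_weight_two_opt:
  assumes "xs \<noteq> []" "ys \<noteq> []"
    and "\<And>i j. i \<in> set xs \<Longrightarrow> j \<in> set xs \<Longrightarrow> g i j = g j i"
  shows "tour_weight g (rev xs @ ys) = tour_weight g (xs @ ys)
    - g (last xs) (hd ys) - g (last ys) (hd xs) + g (hd xs) (hd ys) + g (last ys) (last xs)"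
  using assms path_weight_rev[of xs g]
  by (simp add: tour_weight_append hd_rev last_rev)

text \<open>
  The pigeonhole argument for long edges. Edges are directed by the traversal, and each one is
  labelled by the cells of its initial and of its end point. If two edges of weight at least \<open>t\<close> had
  the same label, the 2-opt move would join the two initial points and the two end points instead,
  by edges of weight below \<open>t\<close>, contradicting optimality. Directing the edges matters: 2-opt can only
  join initial points with each other.
\<close>
lemma card_long_edges_optimal_tour:
  fixes g :: "'b \<Rightarrow> 'b \<Rightarrow> real" and cell :: "'b \<Rightarrow> 'c"
  defines "succ_node \<equiv> \<lambda>vs k. vs ! (Suc k mod length vs)"
  assumes dist: "distinct vs"
    and opt: "\<And>us. distinct us \<Longrightarrow> set us = set vs \<Longrightarrow> tour_weight g vs \<le> tour_weight g us"
    and sym: "\<And>i j. i \<in> set vs \<Longrightarrow> j \<in> set vs \<Longrightarrow> g i j = g j i"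
    and cell: "\<And>i j. i \<in> set vs \<Longrightarrow> j \<in> set vs \<Longrightarrow> cell i = cell j \<Longrightarrow> g i j < t"
    and T: "finite T" "cell ` set vs \<subseteq> T"
  shows "card {k. k < length vs \<and> t \<le> g (vs ! k) (succ_node vs k)} \<le> card T * card T"
proof -
  define L where "L = {k. k < length vs \<and> t \<le> g (vs ! k) (succ_node vs k)}"
  define e where "e k = (cell (vs ! k), cell (succ_node vs k))" for k
  have no_pair: False if kl: "k \<in> L" "l \<in> L" "k < l" and eq: "e k = e l" for k l
  proof -
    \<comment> \<open>The arc from the end of edge \<open>k\<close> to the start of edge \<open>l\<close> is the one to be reversed.\<close>
    define as xs bs where "as = take (Suc k) vs" "xs = take (l - k) (drop (Suc k) vs)"
      "bs = drop (Suc l) vs"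
    have l: "l < length vs" using kl L_def by simp
    have vs: "vs = as @ xs @ bs"
    proof -
      have "drop (l - k) (drop (Suc k) vs) = drop (Suc l) vs" using kl by simp
      then show ?thesis unfolding as_xs_bs_def by (metis append_take_drop_id)
    qed
    have len: "length as = Suc k" "length xs = l - k" using l kl by (auto simp: as_xs_bs_def)
    have ne: "as \<noteq> []" "xs \<noteq> []" using len kl by auto
    have last_as: "last (bs @ as) = vs ! k"
      using ne len vs by (simp add: last_conv_nth nth_append)
    have hd_xs: "hd xs = succ_node vs k"
      using ne len vs kl l by (simp add: hd_conv_nth nth_append succ_node_def)
    have last_xs: "last xs = vs ! l"
    proof -
      have "last xs = xs ! (l - k - 1)" using ne len by (simp add: last_conv_nth)
      also have "\<dots> = vs ! l" using len kl l by (simp add: as_xs_bs_def)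
      finally show ?thesis .
    qed
    have hd_bs: "hd (bs @ as) = succ_node vs l"
    proof (cases "bs = []")
      case True
      then have "length vs = Suc l" using l by (simp add: as_xs_bs_def)
      moreover have "hd as = vs ! 0" using ne vs by (metis append_is_Nil_conv hd_append2 hd_conv_nth)
      ultimately show ?thesis using True by (simp add: succ_node_def)
    next
      case False
      then have "Suc l < length vs" by (simp add: as_xs_bs_def)
      then show ?thesis using False by (simp add: succ_node_def as_xs_bs_def hd_drop_conv_nth)
    qed
    have sets: "set xs \<subseteq> set vs" "set (bs @ as) \<subseteq> set vs" using vs by auto
    have ne2: "bs @ as \<noteq> []" using ne by simp
    have mem: "last (bs @ as) \<in> set vs" "hd (bs @ as) \<in> set vs" "hd xs \<in> set vs" "last xs \<in> set vs"
      using sets ne ne2 by (meson hd_in_set last_in_set subsetD)+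
    have tw: "tour_weight g vs = tour_weight g (xs @ (bs @ as))"
      using tour_weight_rotate[of g as "xs @ bs"] vs by simp
    have "g i j = g j i" if "i \<in> set xs" "j \<in> set xs" for i j
      by (rule sym) (use that sets in blast)+
    note sym_xs = this
    have "tour_weight g (rev xs @ (bs @ as)) = tour_weight g (xs @ (bs @ as))
       - g (last xs) (hd (bs @ as)) - g (last (bs @ as)) (hd xs)
       + g (hd xs) (hd (bs @ as)) + g (last (bs @ as)) (last xs)"
      by (rule tour_weight_two_opt[OF ne(2) ne2 sym_xs])
    moreover have "g (hd xs) (hd (bs @ as)) < t" "g (last (bs @ as)) (last xs) < t"
      using eq mem unfolding e_def last_as hd_bs last_xs hd_xs by (auto intro!: cell)
    moreover have "t \<le> g (last xs) (hd (bs @ as))" "t \<le> g (last (bs @ as)) (hd xs)"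
      using kl unfolding L_def last_as hd_bs last_xs hd_xs by auto
    moreover have "tour_weight g vs \<le> tour_weight g (rev xs @ (bs @ as))"
      by (rule opt) (use dist vs in auto)
    ultimately show False using tw by linarith
  qed
  have "inj_on e L"
    using no_pair by (metis inj_onI linorder_neqE_nat)
  moreover have "e ` L \<subseteq> T \<times> T"
  proof (rule image_subsetI)
    fix k assume "k \<in> L"
    then have "k < length vs" "Suc k mod length vs < length vs"
      by (auto simp: L_def intro!: mod_less_divisor)
    then show "e k \<in> T \<times> T" using T by (auto simp: e_def succ_node_def)
  qed
  ultimately have "card L \<le> card (T \<times> T)" using T by (intro card_inj_on_le) auto
  then show ?thesis by (simp add: L_def card_cartesian_product)
qed

section \<open>Moving one node of an optimal tour\<close>

lemma spanning_cycles_iff: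
  "3 \<le> n \<Longrightarrow> vs \<in> spanning_cycles n \<longleftrightarrow> distinct vs \<and> set vs = {1..n}"
  using distinct_card[of vs] by (auto simp: spanning_cycles_def)

lemma length_spanning_cycle: "vs \<in> spanning_cycles n \<Longrightarrow> length vs = n"
  using distinct_card[of vs] by (auto simp: spanning_cycles_def)

lemma finite_spanning_cycles: "finite (spanning_cycles n)"
  by (rule finite_subset[OF _ finite_subset_distinct[of "{1..n}"]]) (auto simp: spanning_cycles_def)

lemma spanning_cycles_nonempty: "3 \<le> n \<Longrightarrow> spanning_cycles n \<noteq> {}"
  using spanning_cycles_iff[of n "[1..<Suc n]"] by auto

lemma TSP_le: "vs \<in> spanning_cycles n \<Longrightarrow> TSP h \<alpha> p n \<le> cycle_weight h \<alpha> p vs"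
  unfolding TSP_def by (intro Min_le finite_imageI finite_spanning_cycles imageI)

lemma TSP_attained:
  assumes "3 \<le> n"
  obtains vs where "vs \<in> spanning_cycles n" "TSP h \<alpha> p n = cycle_weight h \<alpha> p vs"
proof -
  have "TSP h \<alpha> p n \<in> cycle_weight h \<alpha> p ` spanning_cycles n"
    unfolding TSP_def
    by (intro Min_in finite_imageI finite_spanning_cycles) (simp add: spanning_cycles_nonempty assms)
  then show ?thesis using that by auto
qed

lemma TSP_cong:
  assumes "\<And>i. i \<in> {1..n} \<Longrightarrow> p i = q i"
  shows "TSP h \<alpha> p n = TSP h \<alpha> q n"
proof -
  have "cycle_weight h \<alpha> p vs = cycle_weight h \<alpha> q vs" if "vs \<in> spanning_cycles n" for vs
    unfolding cycle_weight_eq_tour_weight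
    by (rule tour_weight_cong) (use that assms in \<open>auto simp: spanning_cycles_def\<close>)
  then show ?thesis unfolding TSP_def by (metis (no_types, lifting) image_cong)
qed

lemma compact_unit_square: "compact unit_square"
  by (simp add: unit_square_def compact_cbox)

lemma dist_unit_square_le:
  assumes "x \<in> unit_square" "y \<in> unit_square"
  shows "dist x y \<le> 2"
proof -
  have "norm (x - y) \<le> (\<Sum>i\<in>UNIV. \<bar>(x - y) $ i\<bar>)" by (rule norm_le_l1_cart)
  also have "\<dots> \<le> (\<Sum>i\<in>(UNIV::2 set). 1)"
  proof (rule sum_mono)
    fix i :: 2
    show "\<bar>(x - y) $ i\<bar> \<le> 1"
      using assms by (auto simp: unit_square_def mem_box_cart abs_le_iff dest!: spec[of _ i])
  qed
  finally show ?thesis by (simp add: dist_norm)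
qed

text \<open>
  The square on which \<open>h\<close> is the distance is replaced by its inscribed disc, of radius \<open>2 \<rho>\<close>. The
  movers are confined to the disc of half the radius: then a neighbour closer than \<open>\<rho>\<close> still
  lies in the large disc, and so does an anchor closer than \<open>\<delta> \<le> \<rho>\<close> to a copy.
\<close>
locale locally_euclidean_weight =
  fixes h :: "real^2 \<Rightarrow> real^2 \<Rightarrow> real" and c\<^sub>1 c\<^sub>2 \<rho> \<alpha> :: real and c :: "real^2"
  assumes h_sym: "\<And>x y. x \<in> unit_square \<Longrightarrow> y \<in> unit_square \<Longrightarrow> h x y = h y x"
    and h_bounds: "\<And>x y. x \<in> unit_square \<Longrightarrow> y \<in> unit_square \<Longrightarrow>
      c\<^sub>1 * dist x y \<le> h x y \<and> h x y \<le> c\<^sub>2 * dist x y"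
    and h_dist: "\<And>u v. u \<in> unit_square \<Longrightarrow> v \<in> unit_square \<Longrightarrow>
      u \<in> ball c (2 * \<rho>) \<or> v \<in> ball c (2 * \<rho>) \<Longrightarrow> h u v = dist u v"
    and ball_sub: "ball c (2 * \<rho>) \<subseteq> unit_square"
    and pos: "0 < c\<^sub>1" "0 < c\<^sub>2" "0 < \<rho>" "0 < \<alpha>" "\<alpha> < 1"
begin

lemma h_nonneg: "x \<in> unit_square \<Longrightarrow> y \<in> unit_square \<Longrightarrow> 0 \<le> h x y"
  using h_bounds[of x y] pos by (meson mult_nonneg_nonneg order.trans less_imp_le zero_le_dist)

text \<open>
  Compare an optimal tour with the one obtained by taking node \<open>i\<close> out from between its neighbours
  \<open>b\<close> and \<open>a\<close> and putting it back, at its new position \<open>y\<close>, next to \<open>w\<close>. As \<open>y\<close> and \<open>w\<close> lie in the disc,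
  the insertion costs at most \<open>2 d(y, w)\<^sup>\<alpha>\<close> by subadditivity; the expression in \<open>a\<close> and \<open>b\<close> is the
  saving from the removal.
\<close>
lemma TSP_relocate:
  assumes vs: "vs \<in> spanning_cycles n" "TSP h \<alpha> p n = cycle_weight h \<alpha> p vs"
    and k: "k < n" "i = vs ! k" "a = vs ! (Suc k mod n)"
    and p: "\<And>j. j \<in> {1..n} \<Longrightarrow> p j \<in> unit_square"
    and y: "y \<in> ball c (2 * \<rho>)"
    and w: "w \<in> {1..n}" "w \<noteq> i" "p w \<in> ball c (2 * \<rho>)"
  shows "a \<in> {1..n} - {i} \<and> (\<exists>b \<in> {1..n} - {i}.
      h (p i) (p a) powr \<alpha> + h (p b) (p i) powr \<alpha> - h (p b) (p a) powr \<alpha> - 2 * dist y (p w) powr \<alpha>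
      \<le> TSP h \<alpha> p n - TSP h \<alpha> (p(i := y)) n)"
proof -
  have n: "3 \<le> n" using vs(1) length_spanning_cycle[OF vs(1)] by (simp add: spanning_cycles_def)
  note len = length_spanning_cycle[OF vs(1)]
  have dv: "distinct vs" "set vs = {1..n}" using vs(1) by (auto simp: spanning_cycles_def)
  obtain as bs where vs_eq: "vs = as @ i # bs" and lenas: "length as = k"
  proof (rule that)
    show "vs = take k vs @ i # drop (Suc k) vs" using k len by (simp add: id_take_nth_drop)
  qed (use k len in simp)
  define xs where "xs = bs @ as"
  have dx: "distinct (i # xs)" "set (i # xs) = {1..n}"
    using dv by (auto simp: vs_eq xs_def)
  then have set_xs: "set xs = {1..n} - {i}" by auto
  have lenn: "n = Suc (length as + length bs)" using len by (simp add: vs_eq)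
  then have ne: "xs \<noteq> []" using n by (auto simp: xs_def)
  have hd_xs: "hd xs = a"
  proof (cases "bs = []")
    case True
    moreover from this ne have "as \<noteq> []" by (simp add: xs_def)
    ultimately show ?thesis
      using lenn n lenas k(3) by (simp add: xs_def vs_eq hd_conv_nth nth_append)
  next
    case False
    then show ?thesis using lenn lenas k(3)
      by (simp add: xs_def vs_eq hd_conv_nth nth_append)
  qed
  define b where "b = last xs"
  have ab: "a \<in> {1..n} - {i}" "b \<in> {1..n} - {i}"
    using hd_in_set[OF ne] last_in_set[OF ne] set_xs hd_xs b_def by auto
  define q where "q = p(i := y)"
  define g where "g = (\<lambda>i j. h (p i) (p j) powr \<alpha>)"
  define g' where "g' = (\<lambda>i j. h (q i) (q j) powr \<alpha>)"
  have "TSP h \<alpha> p n = tour_weight g vs"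
    using vs by (simp add: cycle_weight_eq_tour_weight g_def)
  also have "\<dots> = tour_weight g (i # xs)"
    using tour_weight_rotate[of g as "i # bs"] by (simp add: vs_eq xs_def)
  also have "\<dots> = tour_weight g xs + g i a + g b i - g b a"
    using tour_weight_insert[OF ne, of g i] hd_xs b_def by simp
  finally have old: "TSP h \<alpha> p n = tour_weight g xs + g i a + g b i - g b a" .

  have "w \<in> set xs" using w set_xs by simp
  then obtain ys zs where yz: "xs = ys @ w # zs" by (meson split_list)
  \<comment> \<open>Rotated so that the edge entering \<open>w\<close> is the one in which \<open>i\<close> is inserted.\<close>
  define us where "us = w # zs @ ys"
  define e where "e = last us"
  have us: "us \<noteq> []" "set us = set xs" "hd us = w" using yz by (auto simp: us_def)
  have e: "e \<in> {1..n} - {i}" using us set_xs unfolding e_def by (metis last_in_set)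
  have d: "distinct (i # us)" using dx yz by (auto simp: us_def)
  have "i # us \<in> spanning_cycles n"
    using d dx us n by (simp add: spanning_cycles_iff)
  then have "TSP h \<alpha> q n \<le> tour_weight g' (i # us)"
    using TSP_le[of "i # us" n h \<alpha> q] by (simp add: cycle_weight_eq_tour_weight g'_def)
  also have "\<dots> = tour_weight g' us + g' i w + g' e i - g' e w"
    using tour_weight_insert[of us g' i] us e_def by simp
  also have "tour_weight g' us = tour_weight g us"
    by (rule tour_weight_cong) (use us set_xs in \<open>auto simp: g_def g'_def q_def\<close>)
  also have "tour_weight g us = tour_weight g xs"
    using tour_weight_rotate[of g ys "w # zs"] yz us_def by simp
  finally have new: "TSP h \<alpha> q n \<le> tour_weight g xs + g' i w + g' e i - g' e w" .
  have "g' i w + g' e i - g' e w \<le> 2 * dist y (p w) powr \<alpha>" 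
  proof -
    have yS: "y \<in> unit_square" using y ball_sub by auto
    have wS: "p w \<in> unit_square" "p e \<in> unit_square" using p w e by auto
    have "g' i w = dist y (p w) powr \<alpha>" using w yS wS y by (simp add: g'_def q_def h_dist)
    moreover have "g' e i = dist (p e) y powr \<alpha>"
      using e yS wS y by (simp add: g'_def q_def h_dist)
    moreover have "g' e w = dist (p e) (p w) powr \<alpha>"
      using e w yS wS y by (simp add: g'_def q_def h_dist)
    moreover have "dist (p e) y powr \<alpha> \<le> (dist (p e) (p w) + dist y (p w)) powr \<alpha>"
      using pos dist_triangle[of "p e" y "p w"]
      by (intro powr_mono2) (auto simp: dist_commute)
    moreover have "\<dots> \<le> dist (p e) (p w) powr \<alpha> + dist y (p w) powr \<alpha>"
      using pos by (intro powr_subadditive) auto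
    ultimately show ?thesis by linarith
  qed
  with new have "TSP h \<alpha> q n \<le> tour_weight g xs + 2 * dist y (p w) powr \<alpha>" by linarith
  with old ab show ?thesis unfolding g_def q_def by (intro conjI bexI[of _ b]) auto
qed

text \<open>
  If the edge from \<open>i\<close> to its successor \<open>a\<close> is shorter than \<open>\<rho>\<close>, then \<open>a\<close> lies in the disc, all three
  weights are powers of distances, and the saving is nonnegative, and at least \<open>(2 - 2\<^sup>\<alpha>) r\<^sup>\<alpha>\<close> if \<open>i\<close> is
  isolated. Otherwise the saving can be negative, but not below \<open>- (2 c\<^sub>2)\<^sup>\<alpha>\<close>, as the unit square
  has diameter at most \<open>2\<close>; the further \<open>2\<close> in the penalty absorbs the gain \<open>(2 - 2\<^sup>\<alpha>) r\<^sup>\<alpha> \<le> 2\<close>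
  credited on the left-hand side.
\<close>
lemma relocate_gain:
  assumes vs: "vs \<in> spanning_cycles n" "TSP h \<alpha> p n = cycle_weight h \<alpha> p vs"
    and k: "k < n" "i = vs ! k" "a = vs ! (Suc k mod n)"
    and p: "\<And>j. j \<in> {1..n} \<Longrightarrow> p j \<in> unit_square"
    and pi: "p i \<in> ball c \<rho>" and y: "y \<in> ball c \<rho>"
    and w: "w \<in> {1..n}" "w \<noteq> i" "dist y (p w) < \<delta>"
    and \<delta>: "\<delta> \<le> \<rho>" and r: "0 < r" "r \<le> 1"
  shows "(2 - 2 powr \<alpha>) * r powr \<alpha> * of_bool (\<forall>j\<in>{1..n} - {i}. r \<le> dist (p i) (p j))
      - 2 * \<delta> powr \<alpha> - ((2 * c\<^sub>2) powr \<alpha> + 2) * of_bool (\<rho> powr \<alpha> \<le> h (p i) (p a) powr \<alpha>)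
    \<le> TSP h \<alpha> p n - TSP h \<alpha> (p(i := y)) n"
proof -
  define I where "I \<longleftrightarrow> (\<forall>j\<in>{1..n} - {i}. r \<le> dist (p i) (p j))"
  have y2: "y \<in> ball c (2 * \<rho>)" using y pos by simp
  have pw: "p w \<in> ball c (2 * \<rho>)"
    using y w \<delta> dist_triangle[of c "p w" y] by simp
  obtain b where a: "a \<in> {1..n} - {i}" and b: "b \<in> {1..n} - {i}"
    and main: "h (p i) (p a) powr \<alpha> + h (p b) (p i) powr \<alpha> - h (p b) (p a) powr \<alpha>
      - 2 * dist y (p w) powr \<alpha> \<le> TSP h \<alpha> p n - TSP h \<alpha> (p(i := y)) n"
    using TSP_relocate[OF vs k p y2 w(1,2) pw] by metis
  have S: "p a \<in> unit_square" "p b \<in> unit_square" using a b p by auto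
  have pi2: "p i \<in> ball c (2 * \<rho>)" using pi pos by simp
  then have iS: "p i \<in> unit_square" using ball_sub by auto
  have d: "h (p i) (p a) = dist (p i) (p a)" "h (p b) (p i) = dist (p b) (p i)"
    using h_dist iS S pi2 by auto
  have dw: "dist y (p w) powr \<alpha> \<le> \<delta> powr \<alpha>" using w pos by (intro powr_mono2) auto
  have g0: "0 < 2 - 2 powr \<alpha>" "2 - 2 powr \<alpha> \<le> 2" using two_powr_less_two pos by auto
  have r1: "r powr \<alpha> \<le> 1" using powr_mono2[of \<alpha> r 1] r pos by simp
  show ?thesis
  proof (cases "\<rho> powr \<alpha> \<le> h (p i) (p a) powr \<alpha>")
    case True
    have "h (p b) (p a) \<le> 2 * c\<^sub>2"
      using h_bounds[OF S(2,1)] dist_unit_square_le[OF S(2,1)] pos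
        mult_left_mono[of "dist (p b) (p a)" 2 c\<^sub>2] by linarith
    then have "h (p b) (p a) powr \<alpha> \<le> (2 * c\<^sub>2) powr \<alpha>"
      using pos h_nonneg S by (intro powr_mono2) auto
    moreover have "(2 - 2 powr \<alpha>) * r powr \<alpha> * of_bool I \<le> 2 * 1 * 1"
      using g0 r1 by (intro mult_mono) auto
    moreover have "0 \<le> h (p i) (p a) powr \<alpha>" "0 \<le> h (p b) (p i) powr \<alpha>" by simp_all
    moreover have "of_bool (\<rho> powr \<alpha> \<le> h (p i) (p a) powr \<alpha>) = (1::real)" using True by simp
    ultimately show ?thesis
      using main dw unfolding I_def[symmetric] by (simp only: mult_1_right)
  next
    case False
    then have "dist (p i) (p a) < \<rho>"
      unfolding d using pos powr_mono2[of \<alpha> \<rho> "dist (p i) (p a)"] by fastforce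
    then have "p a \<in> ball c (2 * \<rho>)" using pi dist_triangle[of c "p a" "p i"] by simp
    then have ba: "h (p b) (p a) = dist (p b) (p a)" using h_dist S by auto
    have tri: "dist (p b) (p a) powr \<alpha> \<le> (dist (p i) (p a) + dist (p b) (p i)) powr \<alpha>"
      using pos dist_triangle[of "p b" "p a" "p i"] by (intro powr_mono2) auto
    have "(2 - 2 powr \<alpha>) * r powr \<alpha> * of_bool I
      \<le> dist (p i) (p a) powr \<alpha> + dist (p b) (p i) powr \<alpha>
        - (dist (p i) (p a) + dist (p b) (p i)) powr \<alpha>"
    proof (cases I)
      case True
      then show ?thesis
        using powr_strict_subadditive[of r "dist (p i) (p a)" "dist (p b) (p i)" \<alpha>] r pos a b
        by (simp add: I_def dist_commute)
    next
      case False
      then show ?thesis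
        using powr_subadditive[of "dist (p i) (p a)" "dist (p b) (p i)" \<alpha>] pos by simp
    qed
    then show ?thesis using main dw False tri unfolding I_def[symmetric] d ba by simp
  qed
qed

text \<open>
  The bound depends neither on \<open>n\<close> nor on the positions: finitely many
  cells cover the unit square in which points are closer than \<open>\<rho> / c\<^sub>2\<close> and \<open>h\<close> is therefore below \<open>\<rho>\<close>.
\<close>
lemma card_long_edges_bounded:
  "\<exists>K::nat. \<forall>n p vs. vs \<in> spanning_cycles n \<longrightarrow> TSP h \<alpha> p n = cycle_weight h \<alpha> p vs \<longrightarrow>
    (\<forall>j\<in>{1..n}. p j \<in> unit_square) \<longrightarrow>
    card {k. k < n \<and> \<rho> powr \<alpha> \<le> h (p (vs ! k)) (p (vs ! (Suc k mod n))) powr \<alpha>} \<le> K"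
proof -
  define \<eta> where "\<eta> = \<rho> / c\<^sub>2"
  have "0 < \<eta> / 2" using pos by (simp add: \<eta>_def)
  then obtain T where T: "finite T" "unit_square \<subseteq> (\<Union>x\<in>T. ball x (\<eta> / 2))"
    using compact_unit_square by (metis compact_eq_totally_bounded)
  then have "\<forall>x. \<exists>t. x \<in> unit_square \<longrightarrow> t \<in> T \<and> dist t x < \<eta> / 2"
    by (meson UN_E mem_ball subsetD)
  then obtain cell where cell: "x \<in> unit_square \<Longrightarrow> cell x \<in> T \<and> dist (cell x) x < \<eta> / 2" for x
    by metis
  show ?thesis
  proof (intro exI[of _ "card T * card T"] allI impI)
    fix n p vs
    assume vs: "vs \<in> spanning_cycles n" "TSP h \<alpha> p n = cycle_weight h \<alpha> p vs"
      and "\<forall>j\<in>{1..n}. p j \<in> unit_square"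
    then have p: "p j \<in> unit_square" if "j \<in> {1..n}" for j using that by blast
    define g where "g = (\<lambda>i j. h (p i) (p j) powr \<alpha>)"
    have dv: "distinct vs" "set vs = {1..n}" "length vs = n" "3 \<le> n"
      using vs(1) length_spanning_cycle[OF vs(1)] by (auto simp: spanning_cycles_def)
    have "card {k. k < length vs \<and> \<rho> powr \<alpha> \<le> g (vs ! k) (vs ! (Suc k mod length vs))}
      \<le> card T * card T"
    proof (rule card_long_edges_optimal_tour[where cell = "\<lambda>i. cell (p i)"])
      fix us assume "distinct us" "set us = set vs"
      then have "us \<in> spanning_cycles n" using dv by (simp add: spanning_cycles_iff)
      then show "tour_weight g vs \<le> tour_weight g us"
        using TSP_le[of us n h \<alpha> p] vs by (simp add: cycle_weight_eq_tour_weight g_def)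
    next
      fix i j assume ij: "i \<in> set vs" "j \<in> set vs" "cell (p i) = cell (p j)"
      then have S: "p i \<in> unit_square" "p j \<in> unit_square" using dv p by auto
      have "dist (p i) (p j) < \<eta>"
        using cell[OF S(1)] cell[OF S(2)] ij dist_triangle_half_r[of "cell (p i)" "p i" \<eta> "p j"] by simp
      then have "c\<^sub>2 * dist (p i) (p j) < \<rho>" using pos by (simp add: \<eta>_def field_simps)
      then have "h (p i) (p j) < \<rho>" using h_bounds[OF S] by simp
      then show "g i j < \<rho> powr \<alpha>"
        unfolding g_def using h_nonneg S pos by (intro powr_less_mono2) auto
    next
      fix i j assume "i \<in> set vs" "j \<in> set vs"
      then show "g i j = g j i" using dv p h_sym by (simp add: g_def)
    qed (use T dv p cell in auto)
    then show "card {k. k < n \<and> \<rho> powr \<alpha> \<le> h (p (vs ! k)) (p (vs ! (Suc k mod n))) powr \<alpha>}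
      \<le> card T * card T"
      using dv by (simp add: g_def)
  qed
qed

text \<open>
  The nodes are moved one at a time, each from the same configuration \<open>p\<close>, so one optimal tour for
  \<open>p\<close> serves all comparisons. Its boundedly many long edges then cost a constant in total.
\<close>
lemma sum_relocate_gain:
  "\<exists>C::real. \<forall>n p q J \<delta> r. 3 \<le> n \<longrightarrow> J \<subseteq> {1..n} \<longrightarrow> 0 < r \<longrightarrow> r \<le> 1 \<longrightarrow> \<delta> \<le> \<rho> \<longrightarrow>
      (\<forall>j\<in>{1..n}. p j \<in> unit_square) \<longrightarrow>
      (\<forall>i\<in>J. p i \<in> ball c \<rho> \<and> q i \<in> ball c \<rho> \<and> (\<exists>w\<in>{1..n} - {i}. dist (q i) (p w) < \<delta>)) \<longrightarrow>
    (\<Sum>i\<in>J. (2 - 2 powr \<alpha>) * r powr \<alpha> * of_bool (\<forall>j\<in>{1..n} - {i}. r \<le> dist (p i) (p j))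
          - 2 * \<delta> powr \<alpha>) - C
      \<le> (\<Sum>i\<in>J. TSP h \<alpha> p n - TSP h \<alpha> (p(i := q i)) n)"
proof -
  obtain K :: nat where K: "\<forall>n p vs. vs \<in> spanning_cycles n \<longrightarrow>
      TSP h \<alpha> p n = cycle_weight h \<alpha> p vs \<longrightarrow> (\<forall>j\<in>{1..n}. p j \<in> unit_square) \<longrightarrow>
    card {k. k < n \<and> \<rho> powr \<alpha> \<le> h (p (vs ! k)) (p (vs ! (Suc k mod n))) powr \<alpha>} \<le> K"
    using card_long_edges_bounded by (rule exE)
  define C\<^sub>0 where "C\<^sub>0 = (2 * c\<^sub>2) powr \<alpha> + 2"
  have C0: "0 \<le> C\<^sub>0" by (simp add: C\<^sub>0_def)
  show ?thesis
  proof (intro exI[of _ "C\<^sub>0 * K"] allI impI)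
    fix n :: nat and p q :: "nat \<Rightarrow> real^2" and J and \<delta> r :: real
    assume n: "3 \<le> n" and J: "J \<subseteq> {1..n}" and r: "0 < r" "r \<le> 1" and \<delta>: "\<delta> \<le> \<rho>"
      and all_p: "\<forall>j\<in>{1..n}. p j \<in> unit_square"
      and all_q: "\<forall>i\<in>J. p i \<in> ball c \<rho> \<and> q i \<in> ball c \<rho> \<and>
        (\<exists>w\<in>{1..n} - {i}. dist (q i) (p w) < \<delta>)"
    have p: "p j \<in> unit_square" if "j \<in> {1..n}" for j using that all_p by blast
    have q: "p i \<in> ball c \<rho> \<and> q i \<in> ball c \<rho> \<and> (\<exists>w\<in>{1..n} - {i}. dist (q i) (p w) < \<delta>)"
      if "i \<in> J" for i using that all_q by blast
    have finJ: "finite J" using J finite_subset by blast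
    obtain vs where vs: "vs \<in> spanning_cycles n" "TSP h \<alpha> p n = cycle_weight h \<alpha> p vs"
      using TSP_attained[OF n] by blast
    have dv: "distinct vs" "set vs = {1..n}" "length vs = n"
      using vs(1) length_spanning_cycle[OF vs(1)] by (auto simp: spanning_cycles_def)
    have "\<forall>i\<in>{1..n}. \<exists>k<n. vs ! k = i" using dv(2,3) by (metis in_set_conv_nth)
    then obtain pos' where pos': "i \<in> {1..n} \<Longrightarrow> pos' i < n \<and> vs ! pos' i = i" for i by metis
    define long where "long k \<longleftrightarrow> \<rho> powr \<alpha> \<le> h (p (vs ! k)) (p (vs ! (Suc k mod n))) powr \<alpha>" for k
    define G where "G i = (2 - 2 powr \<alpha>) * r powr \<alpha> * of_bool (\<forall>j\<in>{1..n} - {i}. r \<le> dist (p i) (p j))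
          - 2 * \<delta> powr \<alpha>" for i
    have each: "G i - C\<^sub>0 * of_bool (long (pos' i)) \<le> TSP h \<alpha> p n - TSP h \<alpha> (p(i := q i)) n"
      if i: "i \<in> J" for i
    proof -
      obtain w where w: "w \<in> {1..n}" "w \<noteq> i" "dist (q i) (p w) < \<delta>" using q[OF i] by blast
      have k: "pos' i < n" "vs ! pos' i = i" using pos' i J by auto
      have "G i - C\<^sub>0 * of_bool (\<rho> powr \<alpha> \<le> h (p i) (p (vs ! (Suc (pos' i) mod n))) powr \<alpha>)
         \<le> TSP h \<alpha> p n - TSP h \<alpha> (p(i := q i)) n"
        unfolding G_def C\<^sub>0_def
        by (rule relocate_gain[OF vs k(1) k(2)[symmetric] refl p _ _ w \<delta> r]) (use q[OF i] in auto)
      then show ?thesis using k unfolding long_def by simp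
    qed
    have inj: "inj_on pos' J" by (rule inj_on_inverseI[where g = "\<lambda>k. vs ! k"]) (use pos' J in auto)
    have "inj_on pos' {i \<in> J. long (pos' i)}" by (rule inj_on_subset[OF inj]) auto
    then have "card {i \<in> J. long (pos' i)} = card (pos' ` {i \<in> J. long (pos' i)})"
      by (rule card_image[symmetric])
    also have "\<dots> \<le> card {k. k < n \<and> long k}"
      using pos' J by (intro card_mono) auto
    also have "\<dots> \<le> K" unfolding long_def using K vs all_p by blast
    finally have card: "real (card {i \<in> J. long (pos' i)}) \<le> K" by simp
    have "(\<Sum>i\<in>J. C\<^sub>0 * of_bool (long (pos' i))) = C\<^sub>0 * card {i \<in> J. long (pos' i)}"
      using finJ by (simp add: sum_distrib_left[symmetric] of_bool_def sum.If_cases Int_def)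
    also have "\<dots> \<le> C\<^sub>0 * K" by (rule mult_left_mono[OF card C0])
    finally have "(\<Sum>i\<in>J. G i) - C\<^sub>0 * K \<le> (\<Sum>i\<in>J. G i - C\<^sub>0 * of_bool (long (pos' i)))"
      by (simp add: sum_subtractf)
    also have "\<dots> \<le> (\<Sum>i\<in>J. TSP h \<alpha> p n - TSP h \<alpha> (p(i := q i)) n)"
      by (rule sum_mono) (rule each)
    finally show "(\<Sum>i\<in>J. (2 - 2 powr \<alpha>) * r powr \<alpha> * of_bool (\<forall>j\<in>{1..n} - {i}. r \<le> dist (p i) (p j))
          - 2 * \<delta> powr \<alpha>) - C\<^sub>0 * K
      \<le> (\<Sum>i\<in>J. TSP h \<alpha> p n - TSP h \<alpha> (p(i := q i)) n)"
      unfolding G_def .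
  qed
qed

end

section \<open>Independent copies of one random point\<close>

text \<open>
  Conditioning on all coordinates but \<open>k\<close>, in a form that needs no conditional expectations: if \<open>A\<close> does
  not depend on coordinate \<open>k\<close>, and given the other coordinates the condition \<open>B\<close> on it has
  probability at most \<open>q\<close>, then it cuts the probability of \<open>A\<close> down by the factor \<open>q\<close>.
\<close>
lemma measure_fresh_coordinate_le:
  fixes \<mu> :: "'b measure" and I :: "'i set"
  defines "P \<equiv> PiM I (\<lambda>_. \<mu>)"
  assumes "prob_space \<mu>" "finite I" "k \<in> I"
    and A: "{p \<in> space P. A p} \<in> sets P"
    and AB: "{p \<in> space P. A p \<and> B p (p k)} \<in> sets P"
    and B: "\<And>p. p \<in> space P \<Longrightarrow> {y \<in> space \<mu>. B p y} \<in> sets \<mu>"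
    and indep: "\<And>p y. A (p(k := y)) = A p" "\<And>p y. B (p(k := y)) = B p"
    and q: "0 \<le> q" "\<And>p. p \<in> space P \<Longrightarrow> A p \<Longrightarrow> measure \<mu> {y \<in> space \<mu>. B p y} \<le> q"
  shows "measure P {p \<in> space P. A p \<and> B p (p k)} \<le> q * measure P {p \<in> space P. A p}"
proof -
  interpret mu: prob_space \<mu> by fact
  interpret prod: product_prob_space "\<lambda>_. \<mu>" I by unfold_locales
  interpret P: prob_space P unfolding P_def by (rule prob_space_PiM) unfold_locales
  define J where "J = I - {k}"
  have J: "finite J" "k \<notin> J" "I = insert k J" using assms by (auto simp: J_def)
  let ?A = "{p \<in> space P. A p}" and ?AB = "{p \<in> space P. A p \<and> B p (p k)}"
  have upd: "x(k := y) \<in> space P" if "x \<in> space (PiM J (\<lambda>_. \<mu>))" "y \<in> space \<mu>" for x y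
    using that unfolding P_def J(3) by (auto simp: space_PiM PiE_iff extensional_def)
  have "emeasure P ?AB = (\<integral>\<^sup>+ p. indicator ?AB p \<partial>P)" using AB by simp
  also have "\<dots> = (\<integral>\<^sup>+ x. (\<integral>\<^sup>+ y. indicator ?AB (x(k := y)) \<partial>\<mu>) \<partial>PiM J (\<lambda>_. \<mu>))"
    unfolding P_def J(3) using AB J
    by (intro prod.product_nn_integral_insert borel_measurable_indicator) (auto simp: P_def)
  also have "\<dots> \<le> (\<integral>\<^sup>+ x. (\<integral>\<^sup>+ y. ennreal q * indicator ?A (x(k := y)) \<partial>\<mu>) \<partial>PiM J (\<lambda>_. \<mu>))"
  proof (rule nn_integral_mono)
    fix x assume x: "x \<in> space (PiM J (\<lambda>_. \<mu>))"
    obtain y\<^sub>0 where y0: "y\<^sub>0 \<in> space \<mu>" using mu.not_empty by blast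
    show "(\<integral>\<^sup>+ y. indicator ?AB (x(k := y)) \<partial>\<mu>) \<le> (\<integral>\<^sup>+ y. ennreal q * indicator ?A (x(k := y)) \<partial>\<mu>)"
    proof (cases "A x")
      case True
      have "(\<integral>\<^sup>+ y. indicator ?AB (x(k := y)) \<partial>\<mu>) = (\<integral>\<^sup>+ y. indicator {y \<in> space \<mu>. B x y} y \<partial>\<mu>)"
        by (rule nn_integral_cong) (use True x indep upd in \<open>auto simp: indicator_def\<close>)
      also have "\<dots> = emeasure \<mu> {y \<in> space \<mu>. B x y}"
        using B[OF upd[OF x y0]] indep by simp
      also have "\<dots> \<le> ennreal q"
        using q(2)[OF upd[OF x y0]] True indep by (simp add: mu.emeasure_eq_measure ennreal_leI)
      also have "\<dots> = (\<integral>\<^sup>+ y. ennreal q \<partial>\<mu>)" by (simp add: mu.emeasure_space_1)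
      also have "\<dots> = (\<integral>\<^sup>+ y. ennreal q * indicator ?A (x(k := y)) \<partial>\<mu>)"
        by (rule nn_integral_cong) (use True x indep upd in \<open>auto simp: indicator_def\<close>)
      finally show ?thesis .
    next
      case False
      then show ?thesis using indep by (simp add: indicator_def)
    qed
  qed
  also have "\<dots> = (\<integral>\<^sup>+ p. ennreal q * indicator ?A p \<partial>P)"
    unfolding P_def J(3) using A J
    by (intro prod.product_nn_integral_insert[symmetric] borel_measurable_times_ennreal
        borel_measurable_indicator borel_measurable_const) (auto simp: P_def)
  also have "\<dots> = ennreal q * emeasure P ?A" using A by (simp add: nn_integral_cmult_indicator)
  finally show ?thesis
    using q(1) by (simp add: P.emeasure_eq_measure ennreal_mult[symmetric])
qed

text \<open>
  The previous bound applied to the negation of \<open>B\<close>.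
\<close>
lemma measure_fresh_coordinate_ge:
  fixes \<mu> :: "'b measure" and I :: "'i set"
  defines "P \<equiv> PiM I (\<lambda>_. \<mu>)"
  assumes "prob_space \<mu>" "finite I" "k \<in> I"
    and A: "{p \<in> space P. A p} \<in> sets P"
    and AB: "{p \<in> space P. A p \<and> B p (p k)} \<in> sets P"
    and B: "\<And>p. p \<in> space P \<Longrightarrow> {y \<in> space \<mu>. B p y} \<in> sets \<mu>"
    and indep: "\<And>p y. A (p(k := y)) = A p" "\<And>p y. B (p(k := y)) = B p"
    and q: "q \<le> 1" "\<And>p. p \<in> space P \<Longrightarrow> A p \<Longrightarrow> q \<le> measure \<mu> {y \<in> space \<mu>. B p y}"
  shows "q * measure P {p \<in> space P. A p} \<le> measure P {p \<in> space P. A p \<and> B p (p k)}"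
proof -
  interpret mu: prob_space \<mu> by fact
  interpret P: prob_space P unfolding P_def by (rule prob_space_PiM) unfold_locales
  let ?A = "{p \<in> space P. A p}" and ?AB = "{p \<in> space P. A p \<and> B p (p k)}"
  have diff: "{p \<in> space P. A p \<and> \<not> B p (p k)} = ?A - ?AB" by auto
  have compl: "measure \<mu> {y \<in> space \<mu>. \<not> B p y} = 1 - measure \<mu> {y \<in> space \<mu>. B p y}"
    if "p \<in> space P" for p using mu.prob_neg[OF B[OF that]] by simp
  have "measure P {p \<in> space P. A p \<and> \<not> B p (p k)} \<le> (1 - q) * measure P ?A"
    unfolding P_def
  proof (rule measure_fresh_coordinate_le[where B = "\<lambda>p y. \<not> B p y"], fold P_def)
    show "{p \<in> space P. A p \<and> \<not> B p (p k)} \<in> sets P"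
      unfolding diff using A AB by (rule sets.Diff)
    show "{y \<in> space \<mu>. \<not> B p y} \<in> sets \<mu>" if "p \<in> space P" for p
    proof -
      have "{y \<in> space \<mu>. \<not> B p y} = space \<mu> - {y \<in> space \<mu>. B p y}" by auto
      then show ?thesis using B[OF that] by auto
    qed
  qed (use assms compl in auto)
  moreover have "measure P {p \<in> space P. A p \<and> \<not> B p (p k)} = measure P ?A - measure P ?AB"
    unfolding diff using A AB by (intro P.finite_measure_Diff) auto
  ultimately show ?thesis by (simp add: algebra_simps)
qed

lemma integral_swap_coordinates:
  fixes \<mu> :: "'b measure" and I :: "'i set" and H :: "('i \<Rightarrow> 'b) \<Rightarrow> real"
  defines "P \<equiv> PiM I (\<lambda>_. \<mu>)"
  assumes "prob_space \<mu>" "i \<in> I" "j \<in> I" and H: "H \<in> borel_measurable P"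
  shows "(\<integral>p. H (p(i := p j, j := p i)) \<partial>P) = (\<integral>p. H p \<partial>P)"
proof -
  define f where "f = id(i := j, j := i)"
  define t :: "('i \<Rightarrow> 'b) \<Rightarrow> 'i \<Rightarrow> 'b" where "t = (\<lambda>\<omega>. \<lambda>n\<in>I. \<omega> (f n))"
  have f: "inj_on f I" "f \<in> I \<rightarrow> I" using assms by (auto simp: f_def inj_on_def)
  have distr: "distr P P t = P"
    unfolding P_def t_def using distr_PiM_reindex[of I "\<lambda>_. \<mu>" f I] f assms(2) by simp
  have [measurable]: "t \<in> measurable P P"
    unfolding P_def t_def 
    by (intro measurable_restrict measurable_component_singleton) (use f in auto)
  have "(\<integral>p. H (p(i := p j, j := p i)) \<partial>P) = (\<integral>p. H (t p) \<partial>P)"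
  proof (rule Bochner_Integration.integral_cong[OF refl])
    fix p assume "p \<in> space P"
    then have "p(i := p j, j := p i) = t p"
      using assms by (auto simp: P_def space_PiM PiE_iff extensional_def t_def f_def fun_eq_iff)
    then show "H (p(i := p j, j := p i)) = H (t p)" by simp
  qed
  also have "\<dots> = (\<integral>p. H p \<partial>distr P P t)"
    using H by (intro integral_distr[symmetric]) auto
  finally show ?thesis using distr by simp
qed

text \<open>
  If \<open>N\<close> of the events occur, then \<open>2 N - N\<^sup>2\<close> is at most \<open>1\<close>, and it is \<open>0\<close> for \<open>N = 0\<close>. Taking
  expectations bounds the probability of the union from below by first and second moments.
\<close>
lemma (in prob_space) prob_Union_ge_half_sum:
  assumes "finite W" and A: "\<And>w. w \<in> W \<Longrightarrow> A w \<in> events"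
    and small: "\<And>w. w \<in> W \<Longrightarrow> (\<Sum>v\<in>W - {w}. prob (A w \<inter> A v)) \<le> prob (A w) / 2"
  shows "(\<Sum>w\<in>W. prob (A w)) / 2 \<le> prob (\<Union>w\<in>W. A w)"
proof -
  have int: "integrable M (indicator (A w) :: 'a \<Rightarrow> real)" if "w \<in> W" for w
    using A[OF that] by (intro integrable_real_indicator) (auto simp: less_top[symmetric])
  have int2: "integrable M (indicator (A w \<inter> A v) :: 'a \<Rightarrow> real)" if "w \<in> W" "v \<in> W" for w v
    using A that by (intro integrable_real_indicator) (auto simp: less_top[symmetric])
  have "(\<Sum>w\<in>W. prob (A w)) / 2 \<le> (\<Sum>w\<in>W. prob (A w) - (\<Sum>v\<in>W - {w}. prob (A w \<inter> A v)))"
    unfolding sum_divide_distrib by (intro sum_mono) (use small in \<open>smt (verit) field_sum_of_halves\<close>)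
  also have "\<dots> = (\<integral>x. (\<Sum>w\<in>W. indicator (A w) x - (\<Sum>v\<in>W - {w}. indicator (A w \<inter> A v) x)) \<partial>M)"
  proof -
    have "(\<integral>x. indicator (A w) x - (\<Sum>v\<in>W - {w}. indicator (A w \<inter> A v) x) \<partial>M)
      = prob (A w) - (\<Sum>v\<in>W - {w}. prob (A w \<inter> A v))" if w: "w \<in> W" for w
    proof -
      have "(\<integral>x. (\<Sum>v\<in>W - {w}. indicator (A w \<inter> A v) x) \<partial>M) = (\<Sum>v\<in>W - {w}. prob (A w \<inter> A v))"
      proof (subst Bochner_Integration.integral_sum)
        show "integrable M (indicator (A w \<inter> A v) :: 'a \<Rightarrow> real)" if "v \<in> W - {w}" for v
          using int2 w that by blast
        have "space M \<inter> (A w \<inter> A v) = A w \<inter> A v" if "v \<in> W" for v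
          using A[OF w] sets.sets_into_space by blast
        then show "(\<Sum>v\<in>W - {w}. \<integral>x. indicator (A w \<inter> A v) x \<partial>M) = (\<Sum>v\<in>W - {w}. prob (A w \<inter> A v))"
          by (intro sum.cong) (auto simp: Int_ac)
      qed
      moreover have "(\<integral>x. indicator (A w) x \<partial>M) = prob (A w)"
        using A[OF w] sets.sets_into_space by (simp add: Int_absorb2)
      moreover have "integrable M (\<lambda>x. \<Sum>v\<in>W - {w}. indicator (A w \<inter> A v) x :: real)"
        using int2 w by (intro Bochner_Integration.integrable_sum) auto
      ultimately show ?thesis using int[OF w] by (simp add: Bochner_Integration.integral_diff)
    qed
    moreover have "(\<integral>x. (\<Sum>w\<in>W. indicator (A w) x - (\<Sum>v\<in>W - {w}. indicator (A w \<inter> A v) x)) \<partial>M)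
      = (\<Sum>w\<in>W. \<integral>x. indicator (A w) x - (\<Sum>v\<in>W - {w}. indicator (A w \<inter> A v) x :: real) \<partial>M)"
      using int int2
      by (intro Bochner_Integration.integral_sum Bochner_Integration.integrable_diff
          Bochner_Integration.integrable_sum) auto
    ultimately show ?thesis by simp
  qed
  also have "\<dots> \<le> (\<integral>x. indicator (\<Union>w\<in>W. A w) x \<partial>M)"
  proof (rule integral_mono)
    show "integrable M (\<lambda>x. \<Sum>w\<in>W. indicator (A w) x - (\<Sum>v\<in>W - {w}. indicator (A w \<inter> A v) x) :: real)"
      using int int2
      by (intro Bochner_Integration.integrable_sum Bochner_Integration.integrable_diff) auto
    show "integrable M (indicator (\<Union>w\<in>W. A w) :: 'a \<Rightarrow> real)"
      using A assms(1) by (intro integrable_real_indicator) (auto simp: less_top[symmetric])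
    fix x
    define N where "N = (\<Sum>w\<in>W. indicator (A w) x :: real)"
    have "(\<Sum>v\<in>W - {w}. indicator (A w \<inter> A v) x) = indicator (A w) x * N - indicator (A w) x"
      if "w \<in> W" for w
    proof -
      have "N = indicator (A w) x + (\<Sum>v\<in>W - {w}. indicator (A v) x)"
        unfolding N_def by (rule sum.remove[OF assms(1) that])
      then show ?thesis
        by (simp add: indicator_inter_arith sum_distrib_left[symmetric] algebra_simps) 
          (simp add: indicator_def)
    qed
    then have "(\<Sum>w\<in>W. indicator (A w) x - (\<Sum>v\<in>W - {w}. indicator (A w \<inter> A v) x) :: real)
      = (\<Sum>w\<in>W. 2 * indicator (A w) x - indicator (A w) x * N)"
      by (intro sum.cong) auto
    also have "\<dots> = 2 * N - N * N"
      
      by (simp add: sum_subtractf sum_distrib_left[symmetric] sum_distrib_right[symmetric] N_def[symmetric])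
    also have "\<dots> \<le> indicator (\<Union>w\<in>W. A w) x"
    proof (cases "x \<in> (\<Union>w\<in>W. A w)")
      case True
      have "0 \<le> (N - 1) * (N - 1)" by simp
      then have "2 * N - N * N \<le> 1" by (simp add: algebra_simps)
      then show ?thesis using True by simp
    next
      case False
      then have "N = 0" by (simp add: N_def)
      then show ?thesis by simp
    qed
    finally show "(\<Sum>w\<in>W. indicator (A w) x - (\<Sum>v\<in>W - {w}. indicator (A w \<inter> A v) x) :: real)
      \<le> indicator (\<Union>w\<in>W. A w) x" .
  qed
  also have "\<dots> = prob (\<Union>w\<in>W. A w)"
    using A assms(1) by (simp add: sets.finite_UN)
  finally show ?thesis .
qed

section \<open>Scores of the movers and a lower bound for variances\<close>

lemma measurable_coordinate_borel:
  assumes "sets \<mu> = sets (restrict_space borel S)" "k \<in> I"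
  shows "(\<lambda>p. p k) \<in> borel_measurable (PiM I (\<lambda>_. \<mu>))"
proof -
  have "(\<lambda>x. x) \<in> measurable (restrict_space borel S) borel"
    by (rule measurable_restrict_space1) simp
  then have "(\<lambda>x. x) \<in> borel_measurable \<mu>"
    using measurable_cong_sets[OF assms(1) refl] by blast
  from measurable_compose[OF measurable_component_singleton[OF assms(2)] this]
  show ?thesis .
qed

lemma borel_measurable_sum_list_map:
  fixes F :: "'b \<Rightarrow> 'c \<Rightarrow> real"
  assumes "\<And>e. e \<in> set l \<Longrightarrow> F e \<in> borel_measurable M"
  shows "(\<lambda>p. \<Sum>e\<leftarrow>l. F e p) \<in> borel_measurable M"
  using assms by (induction l) auto

lemma sum_list_map_bounds:
  fixes F :: "'b \<Rightarrow> real"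
  assumes "\<And>e. e \<in> set l \<Longrightarrow> 0 \<le> F e \<and> F e \<le> C"
  shows "0 \<le> (\<Sum>e\<leftarrow>l. F e) \<and> (\<Sum>e\<leftarrow>l. F e) \<le> real (length l) * C"
  using assms
proof (induction l)
  case (Cons e l)
  then have "0 \<le> F e \<and> F e \<le> C" "0 \<le> (\<Sum>e\<leftarrow>l. F e) \<and> (\<Sum>e\<leftarrow>l. F e) \<le> real (length l) * C"
    by simp_all
  then show ?case by (simp add: algebra_simps)
qed simp

lemma (in prob_space) integrable_bounded:
  fixes f :: "'a \<Rightarrow> real"
  assumes "f \<in> borel_measurable M" "\<And>x. x \<in> space M \<Longrightarrow> \<bar>f x\<bar> \<le> b"
  shows "integrable M f"
  by (rule integrable_const_bound[of _ b]) (use assms in auto)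

text \<open>
  The law \<open>\<mu>\<close> of one site comes with the two-sided bounds for the mass of small discs that the
  density gives: upper bounds make a site isolated with positive probability, and lower bounds make
  a copy fall near an anchor.
\<close>
locale tsp_sample = locally_euclidean_weight +
  fixes \<mu> :: "(real^2) measure" and \<epsilon>\<^sub>1 \<epsilon>\<^sub>2 :: real
  assumes mu_prob: "prob_space \<mu>"
    and mu_sets: "sets \<mu> = sets (restrict_space borel unit_square)"
    and h_measurable: "(\<lambda>(x, y). h x y) \<in> borel_measurable (restrict_space borel (unit_square \<times> unit_square))"
    and eps_pos: "0 < \<epsilon>\<^sub>1" "0 < \<epsilon>\<^sub>2"
    and mu_ball_le: "\<And>x r. x \<in> unit_square \<Longrightarrow> 0 < r \<Longrightarrow>
      measure \<mu> {y \<in> unit_square. dist x y < r} \<le> \<epsilon>\<^sub>2 * pi * r\<^sup>2"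
    and mu_ball_ge: "\<And>x r. ball x r \<subseteq> unit_square \<Longrightarrow> 0 < r \<Longrightarrow>
      \<epsilon>\<^sub>1 * pi * r\<^sup>2 \<le> measure \<mu> {y \<in> unit_square. dist x y < r}"
begin

lemma space_mu: "space \<mu> = unit_square"
  using sets_eq_imp_space_eq[OF mu_sets] by (simp add: space_restrict_space)

text \<open>
  Coordinates \<open>1, \<dots>, n\<close> are the sites. Among them \<open>1, \<dots>, n div 2\<close> are the movers and the others
  the anchors. Coordinate \<open>n + i\<close> is the independent copy of mover \<open>i\<close>.
\<close>
definition sample :: "nat \<Rightarrow> (nat \<Rightarrow> real^2) measure" where
  "sample n = PiM {1..2 * n} (\<lambda>_. \<mu>)"

lemma prob_space_sample: "prob_space (sample n)"
  unfolding sample_def by (rule prob_space_PiM) (rule mu_prob)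

lemma space_sampleD: "p \<in> space (sample n) \<Longrightarrow> k \<in> {1..2 * n} \<Longrightarrow> p k \<in> unit_square"
  by (auto simp: sample_def space_PiM space_mu)

lemma coordinate_measurable: "k \<in> {1..2 * n} \<Longrightarrow> (\<lambda>p. p k) \<in> borel_measurable (sample n)"
  unfolding sample_def by (rule measurable_coordinate_borel[OF mu_sets])

lemma dist_measurable:
  assumes "k \<in> {1..2 * n}" "l \<in> {1..2 * n}"
  shows "(\<lambda>p. dist (p k) (p l)) \<in> borel_measurable (sample n)"
  by (intro borel_measurable_dist coordinate_measurable assms)

lemma sets_dist_less:
  assumes "k \<in> {1..2 * n}" "l \<in> {1..2 * n}"
  shows "{p \<in> space (sample n). dist (p k) (p l) < r} \<in> sets (sample n)"
  using dist_measurable[OF assms] by simp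

lemma sets_in_ball:
  assumes "k \<in> {1..2 * n}"
  shows "{p \<in> space (sample n). p k \<in> ball x r} \<in> sets (sample n)"
proof -
  have "(\<lambda>p. dist x (p k)) \<in> borel_measurable (sample n)"
    by (intro borel_measurable_dist coordinate_measurable assms) simp
  then show ?thesis by simp
qed

lemma sets_ball_mu: "{y \<in> space \<mu>. dist x y < r} \<in> sets \<mu>"
proof -
  have "{y \<in> space \<mu>. dist x y < r} = unit_square \<inter> ball x r"
    by (auto simp: space_mu)
  then show ?thesis by (auto simp: mu_sets sets_restrict_space)
qed

lemma TSP_measurable: "(\<lambda>p. TSP h \<alpha> p n) \<in> borel_measurable (sample n)"
proof -
  have h: "(\<lambda>p. h (p i) (p j)) \<in> borel_measurable (sample n)"
    if "i \<in> {1..n}" "j \<in> {1..n}" for i j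
  proof -
    have ij: "i \<in> {1..2 * n}" "j \<in> {1..2 * n}" using that by auto
    have "(\<lambda>p. (p i, p j)) \<in> measurable (sample n) (borel \<Otimes>\<^sub>M borel)"
      by (intro measurable_Pair coordinate_measurable ij)
    then have "(\<lambda>p. (p i, p j)) \<in> measurable (sample n) (restrict_space borel (unit_square \<times> unit_square))"
      by (intro measurable_restrict_space2) (use space_sampleD ij in \<open>auto simp: borel_prod\<close>)
    from measurable_compose[OF this h_measurable] show ?thesis by simp
  qed
  have "(\<lambda>p. cycle_weight h \<alpha> p vs) \<in> borel_measurable (sample n)" if "vs \<in> spanning_cycles n" for vs
    unfolding cycle_weight_def
  proof (rule borel_measurable_sum_list_map)
    fix e assume e: "e \<in> set (cycle_edges vs)"
    obtain i j where ij: "e = (i, j)" by (cases e)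
    have "i \<in> {1..n}" "j \<in> {1..n}"
      using e that unfolding ij cycle_edges_def
      by (auto simp: spanning_cycles_def dest: set_zip_leftD set_zip_rightD)
    then show "(\<lambda>p. case e of (i, j) \<Rightarrow> h (p i) (p j) powr \<alpha>) \<in> borel_measurable (sample n)"
      unfolding ij using h by simp
  qed
  then show ?thesis unfolding TSP_def
    by (intro borel_measurable_Min finite_spanning_cycles)
qed

lemma TSP_bounds:
  assumes "3 \<le> n" "p \<in> space (sample n)"
  shows "\<bar>TSP h \<alpha> p n\<bar> \<le> real n * (2 * c\<^sub>2) powr \<alpha>"
proof -
  obtain vs where vs: "vs \<in> spanning_cycles n" "TSP h \<alpha> p n = cycle_weight h \<alpha> p vs"
    using TSP_attained[OF assms(1)] by blast
  have "0 \<le> (\<Sum>e\<leftarrow>cycle_edges vs. case e of (i, j) \<Rightarrow> h (p i) (p j) powr \<alpha>)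
    \<and> (\<Sum>e\<leftarrow>cycle_edges vs. case e of (i, j) \<Rightarrow> h (p i) (p j) powr \<alpha>)
      \<le> real (length (cycle_edges vs)) * (2 * c\<^sub>2) powr \<alpha>"
  proof (rule sum_list_map_bounds)
    fix e assume e: "e \<in> set (cycle_edges vs)"
    obtain i j where ij: "e = (i, j)" by (cases e)
    have "i \<in> {1..n}" "j \<in> {1..n}"
      using e vs(1) unfolding ij cycle_edges_def
      by (auto simp: spanning_cycles_def dest: set_zip_leftD set_zip_rightD)
    then have S: "p i \<in> unit_square" "p j \<in> unit_square"
      using space_sampleD[OF assms(2)] by auto
    have "h (p i) (p j) \<le> 2 * c\<^sub>2"
      using h_bounds[OF S] dist_unit_square_le[OF S] pos
        mult_left_mono[of "dist (p i) (p j)" 2 c\<^sub>2] by linarith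
    then show "0 \<le> (case e of (i, j) \<Rightarrow> h (p i) (p j) powr \<alpha>) \<and>
        (case e of (i, j) \<Rightarrow> h (p i) (p j) powr \<alpha>) \<le> (2 * c\<^sub>2) powr \<alpha>"
      unfolding ij using h_nonneg[OF S] pos by (auto intro!: powr_mono2)
  qed
  then show ?thesis
    using vs length_spanning_cycle[OF vs(1)] by (simp add: cycle_weight_def cycle_edges_def)
qed

definition swap_copy :: "nat \<Rightarrow> nat \<Rightarrow> (nat \<Rightarrow> real^2) \<Rightarrow> nat \<Rightarrow> real^2" where
  "swap_copy n i p = p(i := p (n + i), n + i := p i)"

definition near_anchor :: "nat \<Rightarrow> real \<Rightarrow> (nat \<Rightarrow> real^2) \<Rightarrow> real^2 \<Rightarrow> bool" where
  "near_anchor n \<delta> p y \<longleftrightarrow> (\<exists>w\<in>{n div 2 + 1..n}. dist y (p w) < \<delta>)"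

text \<open>
  This part of \<open>movable\<close> is kept separate because it does not involve coordinate \<open>i\<close> itself.
\<close>
definition copy_ready :: "nat \<Rightarrow> real \<Rightarrow> nat \<Rightarrow> (nat \<Rightarrow> real^2) \<Rightarrow> bool" where
  "copy_ready n \<delta> i p \<longleftrightarrow> p (n + i) \<in> ball c \<rho> \<and> near_anchor n \<delta> p (p (n + i))"

definition movable :: "nat \<Rightarrow> real \<Rightarrow> nat \<Rightarrow> (nat \<Rightarrow> real^2) \<Rightarrow> bool" where
  "movable n \<delta> i p \<longleftrightarrow> copy_ready n \<delta> i p \<and> p i \<in> ball c \<rho>"

definition score :: "nat \<Rightarrow> real \<Rightarrow> nat \<Rightarrow> (nat \<Rightarrow> real^2) \<Rightarrow> real" where
  "score n \<delta> i p = of_bool (movable n \<delta> i p) - of_bool (movable n \<delta> i (swap_copy n i p))"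

lemma swap_copy_swap_copy: "swap_copy n i (swap_copy n i p) = p"
  by (auto simp: swap_copy_def)

lemma movable_swap_other:
  assumes "i \<in> {1..n div 2}" "j \<in> {1..n div 2}" "i \<noteq> j"
  shows "movable n \<delta> j (swap_copy n i p) = movable n \<delta> j p"
proof -
  have "swap_copy n i p w = p w" if "w \<in> {n div 2 + 1..n}" for w
    using that assms by (auto simp: swap_copy_def)
  then have "near_anchor n \<delta> (swap_copy n i p) = near_anchor n \<delta> p"
    by (auto simp: near_anchor_def fun_eq_iff)
  moreover have "swap_copy n i p j = p j" "swap_copy n i p (n + j) = p (n + j)"
    using assms by (auto simp: swap_copy_def)
  ultimately show ?thesis by (simp add: movable_def copy_ready_def)
qed

lemma score_swap_self: "score n \<delta> i (swap_copy n i p) = - score n \<delta> i p"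
  by (simp add: score_def swap_copy_swap_copy)

lemma score_swap_other:
  assumes "i \<in> {1..n div 2}" "j \<in> {1..n div 2}" "i \<noteq> j"
  shows "score n \<delta> j (swap_copy n i p) = score n \<delta> j p"
proof -
  have "swap_copy n j (swap_copy n i p) = swap_copy n i (swap_copy n j p)"
    using assms by (auto simp: swap_copy_def fun_eq_iff)
  then show ?thesis using movable_swap_other[OF assms] by (simp add: score_def)
qed

lemma abs_score_le: "\<bar>score n \<delta> i p\<bar> \<le> 1"
  by (simp add: score_def)

text \<open>
  Sites and copies are independent and identically distributed, so exchanging a mover with its
  copy preserves the joint law.
\<close>
lemma integral_swap_copy:
  fixes H :: "(nat \<Rightarrow> real^2) \<Rightarrow> real"
  assumes "i \<in> {1..n}" "H \<in> borel_measurable (sample n)"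
  shows "(\<integral>p. H (swap_copy n i p) \<partial>sample n) = (\<integral>p. H p \<partial>sample n)"
  using integral_swap_coordinates[of \<mu> i "{1..2 * n}" "n + i" H] mu_prob assms
  by (simp add: sample_def swap_copy_def)

lemma sets_copy_ready:
  assumes "i \<in> {1..n}"
  shows "{p \<in> space (sample n). copy_ready n \<delta> i p} \<in> sets (sample n)"
proof -
  have ni: "n + i \<in> {1..2 * n}" using assms by auto
  have "{p \<in> space (sample n). copy_ready n \<delta> i p} =
    {p \<in> space (sample n). p (n + i) \<in> ball c \<rho>} \<inter>
    (\<Union>w\<in>{n div 2 + 1..n}. {p \<in> space (sample n). dist (p (n + i)) (p w) < \<delta>})"
    by (auto simp: copy_ready_def near_anchor_def)
  also have "\<dots> \<in> sets (sample n)"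
    by (intro sets.Int sets.finite_UN sets_in_ball sets_dist_less ni) auto
  finally show ?thesis .
qed

lemma sets_movable:
  assumes "i \<in> {1..n}"
  shows "{p \<in> space (sample n). movable n \<delta> i p} \<in> sets (sample n)"
proof -
  have "{p \<in> space (sample n). movable n \<delta> i p} =
    {p \<in> space (sample n). copy_ready n \<delta> i p} \<inter> {p \<in> space (sample n). p i \<in> ball c \<rho>}"
    by (auto simp: movable_def)
  also have "\<dots> \<in> sets (sample n)"
    using assms by (intro sets.Int sets_copy_ready sets_in_ball) auto
  finally show ?thesis .
qed

lemma swap_copy_measurable:
  assumes "i \<in> {1..n}"
  shows "swap_copy n i \<in> measurable (sample n) (sample n)"
proof -
  have "(\<lambda>p. swap_copy n i p) \<in> measurable (sample n) (PiM {1..2 * n} (\<lambda>_. \<mu>))"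
  proof (rule measurable_PiM_single')
    show "(\<lambda>p. swap_copy n i p k) \<in> measurable (sample n) \<mu>" if "k \<in> {1..2 * n}" for k
      using that assms unfolding swap_copy_def sample_def
      by (cases "k = i"; cases "k = n + i") (auto intro!: measurable_component_singleton)
    show "(\<lambda>p k. swap_copy n i p k) \<in> space (sample n) \<rightarrow> {1..2 * n} \<rightarrow>\<^sub>E space \<mu>"
      using assms by (auto simp: swap_copy_def sample_def space_PiM PiE_iff extensional_def)
  qed
  then show ?thesis by (simp add: sample_def)
qed

lemma movable_measurable:
  assumes "i \<in> {1..n}"
  shows "(\<lambda>p. of_bool (movable n \<delta> i p) :: real) \<in> borel_measurable (sample n)"
  using sets_movable[OF assms] by (simp add: of_bool_def measurable_If)

lemma score_measurable:
  assumes "i \<in> {1..n}"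
  shows "score n \<delta> i \<in> borel_measurable (sample n)"
  unfolding score_def[abs_def]
  by (intro borel_measurable_diff movable_measurable assms
      measurable_compose[OF swap_copy_measurable movable_measurable])

text \<open>
  Cauchy--Schwarz for \<open>F\<close> against the sum \<open>G\<close> of all scores, with the parameter \<open>t\<close> of the usual
  quadratic left free. The exchange of \<open>i\<close> and its copy preserves the law, negates the score of \<open>i\<close>
  and fixes the other scores. Hence the scores are orthogonal and \<open>G\<close> has second moment at most
  \<open>n div 2\<close>. The same exchange turns the covariance of \<open>F\<close> with a score into the expected change of
  \<open>F\<close> under the exchange, restricted to the event that \<open>i\<close> is movable.
\<close>
lemma variance_lower_bound:
  fixes F :: "(nat \<Rightarrow> real^2) \<Rightarrow> real"
  assumes F: "F \<in> borel_measurable (sample n)" "\<And>p. p \<in> space (sample n) \<Longrightarrow> \<bar>F p\<bar> \<le> B"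
    and gain: "L \<le> (\<integral>p. (\<Sum>i\<in>{1..n div 2}. (F p - F (swap_copy n i p)) * of_bool (movable n \<delta> i p)) \<partial>sample n)"
    and t: "0 \<le> t"
  shows "2 * t * L - t\<^sup>2 * real (n div 2) \<le> prob_space.variance (sample n) F"
proof -
  interpret prob_space "sample n" by (rule prob_space_sample)
  define a where "a = expectation F"
  define J where "J = {1..n div 2}"
  have J: "finite J" "\<And>i. i \<in> J \<Longrightarrow> i \<in> {1..n}" by (auto simp: J_def)
  define G where "G p = (\<Sum>i\<in>J. score n \<delta> i p)" for p
  have G_meas: "G \<in> borel_measurable (sample n)"
    unfolding G_def[abs_def] by (intro borel_measurable_sum score_measurable J)
  have G_bd: "\<bar>G p\<bar> \<le> card J" for p
  proof -
    have "\<bar>G p\<bar> \<le> (\<Sum>i\<in>J. \<bar>score n \<delta> i p\<bar>)" unfolding G_def by (rule sum_abs)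
    also have "\<dots> \<le> (\<Sum>i\<in>J. 1)" by (rule sum_mono) (rule abs_score_le)
    finally show ?thesis by simp
  qed
  have Fa_bd: "\<bar>F p - a\<bar> \<le> B + \<bar>a\<bar>" if "p \<in> space (sample n)" for p using F(2)[OF that] by linarith
  have sq: "x\<^sup>2 \<le> b\<^sup>2" if "\<bar>x\<bar> \<le> b" for x b :: real using that by (simp add: abs_le_square_iff[symmetric])
  have int_F2: "integrable (sample n) (\<lambda>p. (F p - a)\<^sup>2)"
    by (rule integrable_bounded[where b = "(B + \<bar>a\<bar>)\<^sup>2"]) (use F Fa_bd sq in auto)
  have int_G2: "integrable (sample n) (\<lambda>p. (G p)\<^sup>2)"
    by (rule integrable_bounded[where b = "(card J)\<^sup>2"]) (use G_meas G_bd sq in auto)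
  have int_FG: "integrable (sample n) (\<lambda>p. (F p - a) * G p)"
  proof (rule integrable_bounded[where b = "(B + \<bar>a\<bar>) * card J"])
    show "\<bar>(F p - a) * G p\<bar> \<le> (B + \<bar>a\<bar>) * card J" if "p \<in> space (sample n)" for p
      unfolding abs_mult by (intro mult_mono Fa_bd G_bd that) (use Fa_bd[OF that] in auto)
  qed (use F G_meas in auto)

  have second: "(\<integral>p. (G p)\<^sup>2 \<partial>sample n) \<le> card J"
  proof -
    have int_ij: "integrable (sample n) (\<lambda>p. score n \<delta> i p * score n \<delta> j p)" if "i \<in> J" "j \<in> J" for i j
    proof (rule integrable_bounded[where b = 1])
      show "\<bar>score n \<delta> i p * score n \<delta> j p\<bar> \<le> 1" for p
        unfolding abs_mult using abs_score_le[of n \<delta> i p] abs_score_le[of n \<delta> j p] 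
        by (intro mult_le_one) auto
    qed (use that J score_measurable in auto)
    \<comment> \<open>Exchanging mover \<open>i\<close> with its copy changes the sign of exactly one factor.\<close>
    have off: "(\<integral>p. score n \<delta> i p * score n \<delta> j p \<partial>sample n) = 0" if "i \<in> J" "j \<in> J" "i \<noteq> j" for i j
    proof -
      have "(\<integral>p. score n \<delta> i p * score n \<delta> j p \<partial>sample n)
        = (\<integral>p. score n \<delta> i (swap_copy n i p) * score n \<delta> j (swap_copy n i p) \<partial>sample n)"
        by (rule integral_swap_copy[symmetric]) (use that J score_measurable in auto)
      also have "\<dots> = - (\<integral>p. score n \<delta> i p * score n \<delta> j p \<partial>sample n)"
        using that score_swap_other[of i n j] by (simp add: score_swap_self J_def)
      finally show ?thesis by simp
    qed
    have "(\<integral>p. (G p)\<^sup>2 \<partial>sample n) = (\<integral>p. (\<Sum>i\<in>J. \<Sum>j\<in>J. score n \<delta> i p * score n \<delta> j p) \<partial>sample n)"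
      by (simp add: G_def power2_eq_square sum_product)
    also have "\<dots> = (\<Sum>i\<in>J. \<Sum>j\<in>J. \<integral>p. score n \<delta> i p * score n \<delta> j p \<partial>sample n)"
      using int_ij by (simp add: Bochner_Integration.integral_sum)
    also have "\<dots> \<le> (\<Sum>i\<in>J. 1)"
    proof (rule sum_mono)
      fix i assume i: "i \<in> J"
      have "(\<Sum>j\<in>J. \<integral>p. score n \<delta> i p * score n \<delta> j p \<partial>sample n)
        = (\<integral>p. score n \<delta> i p * score n \<delta> i p \<partial>sample n)"
        using i J(1) off by (subst sum.remove[OF J(1) i]) (auto intro!: sum.neutral)
      also have "\<dots> \<le> (\<integral>p. 1 \<partial>sample n)"
        using int_ij[OF i i] sq[OF abs_score_le] by (intro integral_mono) (auto simp: power2_eq_square)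
      finally show "(\<Sum>j\<in>J. \<integral>p. score n \<delta> i p * score n \<delta> j p \<partial>sample n) \<le> 1"
        by (simp add: prob_space)
    qed
    finally show ?thesis by simp
  qed

  have cross: "L \<le> (\<integral>p. (F p - a) * G p \<partial>sample n)"
  proof -
    have sw: "(\<lambda>p. f (swap_copy n i p)) \<in> borel_measurable (sample n)"
      if "i \<in> J" "f \<in> borel_measurable (sample n)" for i and f :: "_ \<Rightarrow> real"
      using measurable_compose[OF swap_copy_measurable] that J by blast
    have sw_space: "swap_copy n i p \<in> space (sample n)" if "i \<in> J" "p \<in> space (sample n)" for i p
      using measurable_space[OF swap_copy_measurable] that J by blast
    have one: "(\<integral>p. (F p - a) * score n \<delta> i p \<partial>sample n)
        = (\<integral>p. (F p - F (swap_copy n i p)) * of_bool (movable n \<delta> i p) \<partial>sample n)"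
      and int_one: "integrable (sample n) (\<lambda>p. (F p - a) * score n \<delta> i p)"
      and int_two: "integrable (sample n) (\<lambda>p. (F p - F (swap_copy n i p)) * of_bool (movable n \<delta> i p))"
      if i: "i \<in> J" for i
    proof -
      note mm = movable_measurable[OF J(2)[OF i], of \<delta>]
      have b0: "\<bar>x * of_bool Q\<bar> \<le> B + \<bar>a\<bar>" if "\<bar>x\<bar> \<le> B + \<bar>a\<bar>" for x and Q using that by auto
      have i1: "integrable (sample n) (\<lambda>p. (F p - a) * of_bool (movable n \<delta> i p))"
        by (rule integrable_bounded[where b = "B + \<bar>a\<bar>"])
          (use F mm Fa_bd b0 in \<open>auto simp del: of_bool_eq_iff\<close>)
      have i2: "integrable (sample n) (\<lambda>p. (F p - a) * of_bool (movable n \<delta> i (swap_copy n i p)))"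
        by (rule integrable_bounded[where b = "B + \<bar>a\<bar>"]) (use F sw[OF i mm] Fa_bd b0 in auto)
      have i3: "integrable (sample n) (\<lambda>p. (F (swap_copy n i p) - a) * of_bool (movable n \<delta> i p))"
        by (rule integrable_bounded[where b = "B + \<bar>a\<bar>"]) (use sw[OF i F(1)] mm Fa_bd[OF sw_space[OF i]] b0 in auto)
      have "(\<integral>p. (F p - a) * of_bool (movable n \<delta> i (swap_copy n i p)) \<partial>sample n)
        = (\<integral>p. (F (swap_copy n i p) - a) * of_bool (movable n \<delta> i p) \<partial>sample n)"
        using integral_swap_copy[OF J(2)[OF i] borel_measurable_integrable[OF i3]]
        by (simp add: swap_copy_swap_copy)
      moreover have "(\<lambda>p. (F p - a) * score n \<delta> i p) = (\<lambda>p. (F p - a) * of_bool (movable n \<delta> i p)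
          - (F p - a) * of_bool (movable n \<delta> i (swap_copy n i p)))"
        by (simp add: score_def algebra_simps)
      moreover have "(\<lambda>p. (F p - F (swap_copy n i p)) * of_bool (movable n \<delta> i p))
          = (\<lambda>p. (F p - a) * of_bool (movable n \<delta> i p)
          - (F (swap_copy n i p) - a) * of_bool (movable n \<delta> i p))"
        by (simp add: algebra_simps)
      ultimately show "(\<integral>p. (F p - a) * score n \<delta> i p \<partial>sample n)
          = (\<integral>p. (F p - F (swap_copy n i p)) * of_bool (movable n \<delta> i p) \<partial>sample n)"
        and "integrable (sample n) (\<lambda>p. (F p - a) * score n \<delta> i p)"
        and "integrable (sample n) (\<lambda>p. (F p - F (swap_copy n i p)) * of_bool (movable n \<delta> i p))"
        using i1 i2 i3 by simp_all
    qed
    have "L \<le> (\<Sum>i\<in>J. \<integral>p. (F p - F (swap_copy n i p)) * of_bool (movable n \<delta> i p) \<partial>sample n)"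
      using gain int_two unfolding J_def[symmetric] by (simp add: Bochner_Integration.integral_sum)
    also have "\<dots> = (\<Sum>i\<in>J. \<integral>p. (F p - a) * score n \<delta> i p \<partial>sample n)" using one by simp
    also have "\<dots> = (\<integral>p. (F p - a) * G p \<partial>sample n)"
      using int_one by (simp add: Bochner_Integration.integral_sum G_def sum_distrib_left)
    finally show ?thesis .
  qed

  have "0 \<le> (\<integral>p. (F p - a - t * G p)\<^sup>2 \<partial>sample n)" by simp
  also have "\<dots> = (\<integral>p. (F p - a)\<^sup>2 - 2 * t * ((F p - a) * G p) + t\<^sup>2 * (G p)\<^sup>2 \<partial>sample n)"
    by (simp add: power2_eq_square algebra_simps)
  also have "\<dots> = variance F - 2 * t * (\<integral>p. (F p - a) * G p \<partial>sample n)
      + t\<^sup>2 * (\<integral>p. (G p)\<^sup>2 \<partial>sample n)"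
    using int_F2 int_G2 int_FG by (simp add: a_def)
  finally have "0 \<le> \<dots>" .
  moreover have "2 * t * L \<le> 2 * t * (\<integral>p. (F p - a) * G p \<partial>sample n)"
    using cross t by (intro mult_left_mono) auto
  moreover have "t\<^sup>2 * (\<integral>p. (G p)\<^sup>2 \<partial>sample n) \<le> t\<^sup>2 * card J"
    using second by (intro mult_left_mono) auto
  ultimately show ?thesis by (simp add: J_def)
qed

subsection \<open>Probabilities of isolated and of anchored positions\<close>

definition core_mass :: real where
  "core_mass = measure \<mu> {y \<in> unit_square. dist c y < \<rho>}"

lemma core_mass_pos: "0 < core_mass"
proof -
  have "ball c \<rho> \<subseteq> ball c (2 * \<rho>)" using pos by (intro subset_ball) simp
  then have "\<epsilon>\<^sub>1 * pi * \<rho>\<^sup>2 \<le> core_mass"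
    unfolding core_mass_def using ball_sub pos by (intro mu_ball_ge) auto
  moreover have "0 < \<epsilon>\<^sub>1 * pi * \<rho>\<^sup>2" using eps_pos pos by simp
  ultimately show ?thesis by linarith
qed

lemma core_mass_le_1: "core_mass \<le> 1"
  unfolding core_mass_def using prob_space.prob_le_1[OF mu_prob] .

text \<open>
  There are \<open>n - n div 2\<close> anchors, each within \<open>\<delta>\<close> of a copy in the disc with probability at
  least \<open>\<epsilon>\<^sub>1 \<pi> \<delta>\<^sup>2\<close>. For \<open>\<delta>\<close> of order \<open>n\<^sup>-\<^sup>1\<^sup>/\<^sup>2\<close> the expected number of such anchors is of order one, and the bound on
  \<open>n \<epsilon>\<^sub>2 \<pi> \<delta>\<^sup>2\<close> limits the loss due to several anchors being near at the same time.
\<close>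
lemma prob_copy_ready_ge:
  assumes i: "i \<in> {1..n div 2}"
    and \<delta>: "0 < \<delta>" "\<delta> \<le> \<rho>" "real n * (\<epsilon>\<^sub>2 * pi * \<delta>\<^sup>2) \<le> 1 / 2"
  shows "real (n - n div 2) * (\<epsilon>\<^sub>1 * pi * \<delta>\<^sup>2 * core_mass) / 2
    \<le> measure (sample n) {p \<in> space (sample n). copy_ready n \<delta> i p}"
proof -
  interpret prob_space "sample n" by (rule prob_space_sample)
  define W where "W = {n div 2 + 1..n}"
  have W: "w \<in> {1..2 * n}" "w \<noteq> n + i" if "w \<in> W" for w
    using i that by (auto simp: W_def)
  have ni: "n + i \<in> {1..2 * n}" using i by auto
  define A where "A w = {p \<in> space (sample n). p (n + i) \<in> ball c \<rho> \<and> dist (p (n + i)) (p w) < \<delta>}" for w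
  have A_eq: "A w = {p \<in> space (sample n). p (n + i) \<in> ball c \<rho>} \<inter>
      {p \<in> space (sample n). dist (p (n + i)) (p w) < \<delta>}" for w
    by (auto simp: A_def)
  have A_sets: "A w \<in> sets (sample n)" if "w \<in> W" for w
    unfolding A_eq by (intro sets.Int sets_in_ball sets_dist_less ni W that)
  have ball_in: "{y \<in> unit_square. dist x y < \<delta>} = ball x \<delta> \<and> ball x \<delta> \<subseteq> unit_square"
    if "x \<in> ball c \<rho>" for x
  proof -
    have "ball x \<delta> \<subseteq> ball c (2 * \<rho>)"
    proof
      fix y assume "y \<in> ball x \<delta>"
      then show "y \<in> ball c (2 * \<rho>)" using that \<delta>(2) dist_triangle[of c y x] by simp
    qed
    then show ?thesis using ball_sub by auto
  qed
  have core: "core_mass \<le> prob {p \<in> space (sample n). p (n + i) \<in> ball c \<rho>}"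
  proof -
    have "core_mass * prob {p \<in> space (sample n). True}
      \<le> prob {p \<in> space (sample n). True \<and> p (n + i) \<in> ball c \<rho>}"
      unfolding sample_def
    proof (rule measure_fresh_coordinate_ge[where B = "\<lambda>_ y. y \<in> ball c \<rho>"], fold sample_def)
      show "core_mass \<le> measure \<mu> {y \<in> space \<mu>. y \<in> ball c \<rho>}"
        by (simp add: core_mass_def space_mu)
    qed (use mu_prob ni sets_in_ball[OF ni] core_mass_le_1 sets_ball_mu in auto)
    then show ?thesis by (simp add: prob_space)
  qed
  have one: "\<epsilon>\<^sub>1 * pi * \<delta>\<^sup>2 * core_mass \<le> prob (A w)" if w: "w \<in> W" for w
  proof -
    have "\<epsilon>\<^sub>1 * pi * \<delta>\<^sup>2 * prob {p \<in> space (sample n). p (n + i) \<in> ball c \<rho>}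
      \<le> prob {p \<in> space (sample n). p (n + i) \<in> ball c \<rho> \<and> dist (p (n + i)) (p w) < \<delta>}"
      unfolding sample_def
    proof (rule measure_fresh_coordinate_ge[where B = "\<lambda>p y. dist (p (n + i)) y < \<delta>"], fold sample_def)
      show "{p \<in> space (sample n). p (n + i) \<in> ball c \<rho> \<and> dist (p (n + i)) (p w) < \<delta>} \<in> sets (sample n)"
        using A_sets[OF w] by (simp add: A_def)
      have "c \<in> ball c \<rho>" using pos by simp
      then have "\<epsilon>\<^sub>1 * pi * \<delta>\<^sup>2 \<le> measure \<mu> {y \<in> unit_square. dist c y < \<delta>}"
        using ball_in \<delta> by (intro mu_ball_ge) auto
      then show "\<epsilon>\<^sub>1 * pi * \<delta>\<^sup>2 \<le> 1"
        using prob_space.prob_le_1[OF mu_prob] order.trans by blast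
      show "\<epsilon>\<^sub>1 * pi * \<delta>\<^sup>2 \<le> measure \<mu> {y \<in> space \<mu>. dist (p (n + i)) y < \<delta>}"
        if "p (n + i) \<in> ball c \<rho>" for p
        unfolding space_mu using ball_in[OF that] \<delta> by (intro mu_ball_ge) auto
    qed (use mu_prob W[OF w] sets_in_ball[OF ni] sets_ball_mu in auto)
    moreover have "\<epsilon>\<^sub>1 * pi * \<delta>\<^sup>2 * core_mass
        \<le> \<epsilon>\<^sub>1 * pi * \<delta>\<^sup>2 * prob {p \<in> space (sample n). p (n + i) \<in> ball c \<rho>}"
      using core eps_pos by (intro mult_left_mono) auto
    ultimately show ?thesis by (simp add: A_def)
  qed
  have two: "prob (A w \<inter> A v) \<le> \<epsilon>\<^sub>2 * pi * \<delta>\<^sup>2 * prob (A w)" if w: "w \<in> W" and v: "v \<in> W - {w}" for w v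
  proof -
    have vW: "v \<in> W" "v \<noteq> w" using v by auto
    let ?Q = "\<lambda>p. p (n + i) \<in> ball c \<rho> \<and> dist (p (n + i)) (p w) < \<delta>"
    have eq: "A w \<inter> A v = {p \<in> space (sample n). ?Q p \<and> dist (p (n + i)) (p v) < \<delta>}"
      by (auto simp: A_def)
    have "prob {p \<in> space (sample n). ?Q p \<and> dist (p (n + i)) (p v) < \<delta>}
      \<le> \<epsilon>\<^sub>2 * pi * \<delta>\<^sup>2 * prob {p \<in> space (sample n). ?Q p}"
      unfolding sample_def
    proof (rule measure_fresh_coordinate_le[where B = "\<lambda>p y. dist (p (n + i)) y < \<delta>"], fold sample_def)
      show "{p \<in> space (sample n). ?Q p} \<in> sets (sample n)"
        using A_sets[OF w] by (simp add: A_def)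
      show "{p \<in> space (sample n). ?Q p \<and> dist (p (n + i)) (p v) < \<delta>} \<in> sets (sample n)"
        unfolding eq[symmetric] using A_sets w vW by blast
      show "measure \<mu> {y \<in> space \<mu>. dist (p (n + i)) y < \<delta>} \<le> \<epsilon>\<^sub>2 * pi * \<delta>\<^sup>2"
        if "p \<in> space (sample n)" for p
        unfolding space_mu by (intro mu_ball_le space_sampleD[OF that ni] \<delta>)
    qed (use mu_prob W[OF vW(1)] vW(2) sets_ball_mu eps_pos in auto)
    then show ?thesis unfolding eq by (simp add: A_def)
  qed
  have card_W: "card W = n - n div 2" by (simp add: W_def)
  have "real (n - n div 2) * (\<epsilon>\<^sub>1 * pi * \<delta>\<^sup>2 * core_mass) / 2 \<le> (\<Sum>w\<in>W. prob (A w)) / 2"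
    using sum_mono[OF one, of W "\<lambda>w. w"] card_W by simp
  also have "\<dots> \<le> prob (\<Union>w\<in>W. A w)"
  proof (rule prob_Union_ge_half_sum)
    fix w assume w: "w \<in> W"
    have "(\<Sum>v\<in>W - {w}. prob (A w \<inter> A v)) \<le> (\<Sum>v\<in>W - {w}. \<epsilon>\<^sub>2 * pi * \<delta>\<^sup>2 * prob (A w))"
      by (rule sum_mono) (rule two[OF w])
    also have "\<dots> \<le> real n * (\<epsilon>\<^sub>2 * pi * \<delta>\<^sup>2 * prob (A w))"
    proof -
      have "card (W - {w}) \<le> card W" by (rule card_mono) (auto simp: W_def)
      then have "card (W - {w}) \<le> n" using card_W by linarith
      then show ?thesis using eps_pos by (simp add: mult_right_mono)
    qed
    also have "\<dots> = real n * (\<epsilon>\<^sub>2 * pi * \<delta>\<^sup>2) * prob (A w)" by simp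
    also have "\<dots> \<le> 1 / 2 * prob (A w)" by (intro mult_right_mono \<delta>) simp
    finally show "(\<Sum>v\<in>W - {w}. prob (A w \<inter> A v)) \<le> prob (A w) / 2" by simp
  qed (use A_sets in \<open>auto simp: W_def\<close>)
  also have "(\<Union>w\<in>W. A w) = {p \<in> space (sample n). copy_ready n \<delta> i p}"
    by (auto simp: A_def copy_ready_def near_anchor_def W_def)
  finally show ?thesis .
qed

lemma copy_ready_upd:
  assumes "i \<in> {1..n div 2}" 
  shows "copy_ready n \<delta> i (p(i := y)) = copy_ready n \<delta> i p"
proof -
  have "near_anchor n \<delta> (p(i := y)) = near_anchor n \<delta> p"
    using assms by (auto simp: near_anchor_def fun_eq_iff)
  then show ?thesis using assms by (auto simp: copy_ready_def)
qed

definition far_from_sites :: "nat \<Rightarrow> real \<Rightarrow> nat \<Rightarrow> (nat \<Rightarrow> real^2) \<Rightarrow> bool" where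
  "far_from_sites n r i p \<longleftrightarrow> (\<forall>j\<in>{1..n} - {i}. r \<le> dist (p i) (p j))"

lemma prob_movable_le:
  assumes i: "i \<in> {1..n div 2}"
  shows "measure (sample n) {p \<in> space (sample n). movable n \<delta> i p}
    \<le> core_mass * measure (sample n) {p \<in> space (sample n). copy_ready n \<delta> i p}"
  unfolding sample_def movable_def
proof (rule measure_fresh_coordinate_le[where B = "\<lambda>_ y. y \<in> ball c \<rho>"], fold sample_def)
  have i': "i \<in> {1..n}" using i by auto
  then show "{p \<in> space (sample n). copy_ready n \<delta> i p} \<in> sets (sample n)"
    "{p \<in> space (sample n). copy_ready n \<delta> i p \<and> p i \<in> ball c \<rho>} \<in> sets (sample n)"
    using sets_copy_ready[of i n \<delta>] sets_movable[of i n \<delta>] by (simp_all add: movable_def)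
qed (use i mu_prob copy_ready_upd[OF i] sets_ball_mu core_mass_pos in \<open>auto simp: core_mass_def space_mu\<close>)

lemma sets_far_from_sites:
  assumes "i \<in> {1..n}"
  shows "{p \<in> space (sample n). far_from_sites n r i p} \<in> sets (sample n)"
proof -
  have "{p \<in> space (sample n). far_from_sites n r i p} = space (sample n) -
    (\<Union>j\<in>{1..n} - {i}. {p \<in> space (sample n). dist (p i) (p j) < r})"
    by (force simp: far_from_sites_def)
  also have "\<dots> \<in> sets (sample n)"
    using assms by (intro sets.Diff sets.finite_UN sets.top sets_dist_less) auto
  finally show ?thesis .
qed

text \<open>
  Mover \<open>i\<close> is independent of whether its copy is ready, so placing it in the disc costs a factor
  \<open>core_mass\<close>. The other sites exclude at most \<open>n\<close> discs of radius \<open>r\<close>, which by assumption take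
  away at most half of this mass.
\<close>
lemma prob_movable_isolated_ge:
  assumes i: "i \<in> {1..n div 2}" and r: "0 < r" "real n * (\<epsilon>\<^sub>2 * pi * r\<^sup>2) \<le> core_mass / 2"
  shows "core_mass / 2 * measure (sample n) {p \<in> space (sample n). copy_ready n \<delta> i p}
    \<le> measure (sample n) {p \<in> space (sample n). movable n \<delta> i p \<and> far_from_sites n r i p}"
proof -
  interpret prob_space "sample n" by (rule prob_space_sample)
  have i': "i \<in> {1..n}" using i by auto
  let ?R = "{p \<in> space (sample n). copy_ready n \<delta> i p}"
  let ?M = "{p \<in> space (sample n). movable n \<delta> i p}"
  define N where "N j = {p \<in> space (sample n). copy_ready n \<delta> i p \<and> dist (p j) (p i) < r}" for j
  have N_eq: "N j = ?R \<inter> {p \<in> space (sample n). dist (p j) (p i) < r}" for j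
    by (auto simp: N_def)
  have N_sets: "N j \<in> sets (sample n)" if "j \<in> {1..n}" for j
    unfolding N_eq using that i' by (intro sets.Int sets_copy_ready sets_dist_less) auto
  have M: "core_mass * prob ?R \<le> prob ?M"
    unfolding sample_def movable_def
  proof (rule measure_fresh_coordinate_ge[where B = "\<lambda>_ y. y \<in> ball c \<rho>"], fold sample_def)
    show "?R \<in> sets (sample n)"
      "{p \<in> space (sample n). copy_ready n \<delta> i p \<and> p i \<in> ball c \<rho>} \<in> sets (sample n)"
      using sets_copy_ready[of i n \<delta>] sets_movable[of i n \<delta>] i' by (simp_all add: movable_def)
  qed (use i mu_prob copy_ready_upd[OF i] sets_ball_mu core_mass_le_1 in \<open>auto simp: core_mass_def space_mu\<close>)
  have close: "prob (N j) \<le> \<epsilon>\<^sub>2 * pi * r\<^sup>2 * prob ?R" if j: "j \<in> {1..n} - {i}" for j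
    unfolding N_def sample_def
  proof (rule measure_fresh_coordinate_le[where B = "\<lambda>p y. dist (p j) y < r"], fold sample_def)
    show "?R \<in> sets (sample n)" by (rule sets_copy_ready[OF i'])
    show "{p \<in> space (sample n). copy_ready n \<delta> i p \<and> dist (p j) (p i) < r} \<in> sets (sample n)"
      using N_sets j by (simp add: N_def)
    show "measure \<mu> {y \<in> space \<mu>. dist (p j) y < r} \<le> \<epsilon>\<^sub>2 * pi * r\<^sup>2"
      if p: "p \<in> space (sample n)" for p
      unfolding space_mu using j by (intro mu_ball_le space_sampleD[OF p] r) auto
  qed (use i j mu_prob copy_ready_upd[OF i] sets_ball_mu eps_pos in auto)
  have "prob ?M \<le> prob ({p \<in> space (sample n). movable n \<delta> i p \<and> far_from_sites n r i p} \<union> (\<Union>j\<in>{1..n} - {i}. N j))"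
  proof (rule finite_measure_mono)
    have "{p \<in> space (sample n). movable n \<delta> i p \<and> far_from_sites n r i p} =
      ?M \<inter> {p \<in> space (sample n). far_from_sites n r i p}" by auto
    then show "{p \<in> space (sample n). movable n \<delta> i p \<and> far_from_sites n r i p} \<union> (\<Union>j\<in>{1..n} - {i}. N j) \<in> sets (sample n)"
      using sets_movable[OF i', of \<delta>] sets_far_from_sites[OF i', of r] N_sets
      by (intro sets.Un sets.finite_UN) auto
    show "?M \<subseteq> {p \<in> space (sample n). movable n \<delta> i p \<and> far_from_sites n r i p} \<union> (\<Union>j\<in>{1..n} - {i}. N j)"
      by (force simp: far_from_sites_def movable_def N_def dist_commute not_le)
  qed
  also have "\<dots> \<le> prob {p \<in> space (sample n). movable n \<delta> i p \<and> far_from_sites n r i p} + prob (\<Union>j\<in>{1..n} - {i}. N j)"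
  proof (rule measure_Un_le)
    have "{p \<in> space (sample n). movable n \<delta> i p \<and> far_from_sites n r i p} =
      ?M \<inter> {p \<in> space (sample n). far_from_sites n r i p}" by auto
    then show "{p \<in> space (sample n). movable n \<delta> i p \<and> far_from_sites n r i p} \<in> sets (sample n)"
      using sets_movable[OF i', of \<delta>] sets_far_from_sites[OF i', of r] by auto
    show "(\<Union>j\<in>{1..n} - {i}. N j) \<in> sets (sample n)" using N_sets by (intro sets.finite_UN) auto
  qed
  also have "prob (\<Union>j\<in>{1..n} - {i}. N j) \<le> (\<Sum>j\<in>{1..n} - {i}. prob (N j))"
    using N_sets by (intro finite_measure_subadditive_finite) auto
  also have "\<dots> \<le> (\<Sum>j\<in>{1..n} - {i}. \<epsilon>\<^sub>2 * pi * r\<^sup>2 * prob ?R)" by (rule sum_mono) (rule close)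
  also have "\<dots> \<le> real n * (\<epsilon>\<^sub>2 * pi * r\<^sup>2 * prob ?R)"
    using eps_pos i' by (simp add: mult_right_mono)
  also have "\<dots> = real n * (\<epsilon>\<^sub>2 * pi * r\<^sup>2) * prob ?R" by simp
  also have "\<dots> \<le> core_mass / 2 * prob ?R" using r by (intro mult_right_mono) auto
  finally show ?thesis using M by (simp add: field_simps)
qed

subsection \<open>The expected gain\<close>

definition total_gain :: "nat \<Rightarrow> real \<Rightarrow> (nat \<Rightarrow> real^2) \<Rightarrow> real" where
  "total_gain n \<delta> p = (\<Sum>i\<in>{1..n div 2}.
     (TSP h \<alpha> p n - TSP h \<alpha> (swap_copy n i p) n) * of_bool (movable n \<delta> i p))"

text \<open>
  On the sites, exchanging mover \<open>i\<close> with its copy is the same as moving \<open>i\<close> to the position of the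
  copy, and the anchor near the copy is the node next to which \<open>i\<close> is reinserted.
\<close>
lemma total_gain_pointwise:
  "\<exists>C. \<forall>n r \<delta> p. 3 \<le> n \<longrightarrow> 0 < r \<longrightarrow> r \<le> 1 \<longrightarrow> \<delta> \<le> \<rho> \<longrightarrow> p \<in> space (sample n) \<longrightarrow>
    (\<Sum>i\<in>{1..n div 2}. (2 - 2 powr \<alpha>) * r powr \<alpha> * of_bool (movable n \<delta> i p \<and> far_from_sites n r i p)
      - 2 * \<delta> powr \<alpha> * of_bool (movable n \<delta> i p)) - C \<le> total_gain n \<delta> p"
proof -
  obtain C where C: "\<forall>n p q J \<delta> r. 3 \<le> n \<longrightarrow> J \<subseteq> {1..n} \<longrightarrow> 0 < r \<longrightarrow> r \<le> 1 \<longrightarrow> \<delta> \<le> \<rho> \<longrightarrow>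
      (\<forall>j\<in>{1..n}. p j \<in> unit_square) \<longrightarrow>
      (\<forall>i\<in>J. p i \<in> ball c \<rho> \<and> q i \<in> ball c \<rho> \<and> (\<exists>w\<in>{1..n} - {i}. dist (q i) (p w) < \<delta>)) \<longrightarrow>
    (\<Sum>i\<in>J. (2 - 2 powr \<alpha>) * r powr \<alpha> * of_bool (\<forall>j\<in>{1..n} - {i}. r \<le> dist (p i) (p j))
          - 2 * \<delta> powr \<alpha>) - C
      \<le> (\<Sum>i\<in>J. TSP h \<alpha> p n - TSP h \<alpha> (p(i := q i)) n)"
    using sum_relocate_gain by (rule exE)
  show ?thesis
  proof (intro exI[of _ C] allI impI)
    fix n :: nat and r \<delta> :: real and p
    assume n: "3 \<le> n" and r: "0 < r" "r \<le> 1" and \<delta>: "\<delta> \<le> \<rho>" and p: "p \<in> space (sample n)"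
    define J where "J = {i \<in> {1..n div 2}. movable n \<delta> i p}"
    have swap: "TSP h \<alpha> (swap_copy n i p) n = TSP h \<alpha> (p(i := p (n + i))) n" if "i \<in> J" for i
      by (rule TSP_cong) (use that in \<open>auto simp: swap_copy_def J_def\<close>)
    have mov: "p i \<in> ball c \<rho> \<and> p (n + i) \<in> ball c \<rho> \<and> (\<exists>w\<in>{1..n} - {i}. dist (p (n + i)) (p w) < \<delta>)"
      if i: "i \<in> J" for i
    proof -
      have "movable n \<delta> i p" "i \<le> n div 2" using i by (auto simp: J_def)
      then obtain w where "w \<in> {n div 2 + 1..n}" "dist (p (n + i)) (p w) < \<delta>"
        and "p i \<in> ball c \<rho>" "p (n + i) \<in> ball c \<rho>"
        unfolding movable_def copy_ready_def near_anchor_def by blast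
      moreover have "w \<in> {1..n} - {i}" using \<open>i \<le> n div 2\<close> \<open>w \<in> {n div 2 + 1..n}\<close> by simp
      ultimately show ?thesis by blast
    qed
    have "(\<Sum>i\<in>J. (2 - 2 powr \<alpha>) * r powr \<alpha> * of_bool (\<forall>j\<in>{1..n} - {i}. r \<le> dist (p i) (p j))
          - 2 * \<delta> powr \<alpha>) - C
      \<le> (\<Sum>i\<in>J. TSP h \<alpha> p n - TSP h \<alpha> (p(i := p (n + i))) n)"
    proof (rule C[rule_format, OF n _ r \<delta>])
      show "J \<subseteq> {1..n}" by (auto simp: J_def)
      show "p j \<in> unit_square" if "j \<in> {1..n}" for j
        by (rule space_sampleD[OF p]) (use that in auto)
    qed (use mov in blast)
    also have "\<dots> = total_gain n \<delta> p"
      unfolding total_gain_def J_def sum.inter_filter[OF finite_atLeastAtMost]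
      by (intro sum.cong refl) (auto simp: swap[unfolded J_def])
    also have "(\<Sum>i\<in>J. (2 - 2 powr \<alpha>) * r powr \<alpha> * of_bool (\<forall>j\<in>{1..n} - {i}. r \<le> dist (p i) (p j))
          - 2 * \<delta> powr \<alpha>)
      = (\<Sum>i\<in>{1..n div 2}. (2 - 2 powr \<alpha>) * r powr \<alpha> * of_bool (movable n \<delta> i p \<and> far_from_sites n r i p)
          - 2 * \<delta> powr \<alpha> * of_bool (movable n \<delta> i p))"
      unfolding J_def far_from_sites_def
      by (subst sum.inter_filter) (auto intro!: sum.cong)
    finally show "(\<Sum>i\<in>{1..n div 2}. (2 - 2 powr \<alpha>) * r powr \<alpha> * of_bool (movable n \<delta> i p \<and> far_from_sites n r i p)
          - 2 * \<delta> powr \<alpha> * of_bool (movable n \<delta> i p)) - C \<le> total_gain n \<delta> p" .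
  qed
qed

text \<open>
  The gain is earned with probability at least half the one with which the cost \<open>2 \<delta>\<^sup>\<alpha>\<close> has to be
  paid. Since that cost is at most a quarter of the gain, a quarter of the gain survives.
\<close>
lemma expected_total_gain_ge:
  assumes C: "\<And>p. p \<in> space (sample n) \<Longrightarrow>
      (\<Sum>i\<in>{1..n div 2}. (2 - 2 powr \<alpha>) * r powr \<alpha> * of_bool (movable n \<delta> i p \<and> far_from_sites n r i p)
      - 2 * \<delta> powr \<alpha> * of_bool (movable n \<delta> i p)) - C \<le> total_gain n \<delta> p"
    and n: "3 \<le> n"
    and r: "0 < r" "real n * (\<epsilon>\<^sub>2 * pi * r\<^sup>2) \<le> core_mass / 2"
    and \<delta>: "2 * \<delta> powr \<alpha> \<le> (2 - 2 powr \<alpha>) / 4 * r powr \<alpha>"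
    and \<beta>: "0 \<le> \<beta>" "\<And>i. i \<in> {1..n div 2} \<Longrightarrow>
      \<beta> \<le> measure (sample n) {p \<in> space (sample n). copy_ready n \<delta> i p}"
  shows "real (n div 2) * (\<beta> * core_mass * ((2 - 2 powr \<alpha>) / 4) * r powr \<alpha>) - C
    \<le> (\<integral>p. total_gain n \<delta> p \<partial>sample n)"
proof -
  interpret prob_space "sample n" by (rule prob_space_sample)
  define a where "a = (2 - 2 powr \<alpha>) * r powr \<alpha>"
  define b where "b = 2 * \<delta> powr \<alpha>"
  define J where "J = {1..n div 2}"
  have a: "0 \<le> a" using two_powr_less_two[of \<alpha>] pos by (simp add: a_def)
  have b: "0 \<le> b" "b \<le> a / 4" using \<delta> by (simp_all add: a_def b_def)
  have J: "i \<in> {1..n}" if "i \<in> J" for i using that by (auto simp: J_def)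
  let ?E = "\<lambda>i. {p \<in> space (sample n). movable n \<delta> i p \<and> far_from_sites n r i p}"
  let ?M = "\<lambda>i. {p \<in> space (sample n). movable n \<delta> i p}"
  have M_sets: "?M i \<in> sets (sample n)" if "i \<in> J" for i by (rule sets_movable[OF J[OF that]])
  have E_sets: "?E i \<in> sets (sample n)" if "i \<in> J" for i
  proof -
    have "?E i = ?M i \<inter> {p \<in> space (sample n). far_from_sites n r i p}" by auto
    then show ?thesis using M_sets[OF that] sets_far_from_sites[OF J[OF that], of r] by simp
  qed
  have int: "integrable (sample n) (\<lambda>p. a * indicator (?E i) p - b * indicator (?M i) p :: real)"
    and val: "(\<integral>p. a * indicator (?E i) p - b * indicator (?M i) p \<partial>sample n) = a * prob (?E i) - b * prob (?M i)"
    if i: "i \<in> J" for i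
  proof -
    have i1: "integrable (sample n) (\<lambda>p. a * indicator (?E i) p :: real)"
      using E_sets[OF i] by (intro integrable_mult_right integrable_real_indicator) (auto simp: less_top[symmetric])
    have i2: "integrable (sample n) (\<lambda>p. b * indicator (?M i) p :: real)"
      using M_sets[OF i] by (intro integrable_mult_right integrable_real_indicator) (auto simp: less_top[symmetric])
    show "integrable (sample n) (\<lambda>p. a * indicator (?E i) p - b * indicator (?M i) p :: real)"
      by (rule Bochner_Integration.integrable_diff[OF i1 i2])
    have "?E i \<inter> space (sample n) = ?E i" "?M i \<inter> space (sample n) = ?M i" by auto
    then show "(\<integral>p. a * indicator (?E i) p - b * indicator (?M i) p \<partial>sample n) = a * prob (?E i) - b * prob (?M i)"
      using Bochner_Integration.integral_diff[OF i1 i2] by simp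
  qed
  have int_gain: "integrable (sample n) (total_gain n \<delta>)"
    unfolding total_gain_def[abs_def]
  proof (rule Bochner_Integration.integrable_sum)
    fix i assume "i \<in> {1..n div 2}"
    then have i: "i \<in> {1..n}" by auto
    define B where "B = real n * (2 * c\<^sub>2) powr \<alpha>"
    have sw: "swap_copy n i p \<in> space (sample n)" if "p \<in> space (sample n)" for p
      using measurable_space[OF swap_copy_measurable[OF i] that] .
    show "integrable (sample n) (\<lambda>p. (TSP h \<alpha> p n - TSP h \<alpha> (swap_copy n i p) n) * of_bool (movable n \<delta> i p))"
    proof (rule integrable_bounded[where b = "2 * B"])
      show "\<bar>(TSP h \<alpha> p n - TSP h \<alpha> (swap_copy n i p) n) * of_bool (movable n \<delta> i p)\<bar> \<le> 2 * B"
        if p: "p \<in> space (sample n)" for p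
        using TSP_bounds[OF n p] TSP_bounds[OF n sw[OF p]] by (auto simp: B_def)
      show "(\<lambda>p. (TSP h \<alpha> p n - TSP h \<alpha> (swap_copy n i p) n) * of_bool (movable n \<delta> i p)) \<in> borel_measurable (sample n)"
        by (intro borel_measurable_times borel_measurable_diff TSP_measurable movable_measurable i
            measurable_compose[OF swap_copy_measurable[OF i] TSP_measurable])
    qed
  qed
  have "real (n div 2) * (\<beta> * core_mass * ((2 - 2 powr \<alpha>) / 4) * r powr \<alpha>) = (\<Sum>i\<in>J. \<beta> * core_mass * (a / 4))"
    by (simp add: J_def a_def)
  also have "\<dots> \<le> (\<Sum>i\<in>J. a * prob (?E i) - b * prob (?M i))"
  proof (rule sum_mono)
    fix i assume i: "i \<in> J"
    define P where "P = prob {p \<in> space (sample n). copy_ready n \<delta> i p}"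
    have "\<beta> * (core_mass * (a / 4)) \<le> P * (core_mass * (a / 4))"
      unfolding P_def using \<beta>(2)[of i] i a core_mass_pos by (intro mult_right_mono) (auto simp: J_def)
    moreover have "a * (core_mass / 2 * P) \<le> a * prob (?E i)"
      unfolding P_def using prob_movable_isolated_ge[of i n r \<delta>] i r a
      by (intro mult_left_mono) (auto simp: J_def)
    moreover have "b * prob (?M i) \<le> a / 4 * (core_mass * P)"
      unfolding P_def using prob_movable_le[of i n \<delta>] i a b
      by (intro mult_mono) (auto simp: J_def)
    ultimately show "\<beta> * core_mass * (a / 4) \<le> a * prob (?E i) - b * prob (?M i)"
      by (simp add: field_simps)
  qed
  also have "\<dots> = (\<integral>p. (\<Sum>i\<in>J. a * indicator (?E i) p - b * indicator (?M i) p) \<partial>sample n)"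
    using int val by (simp add: Bochner_Integration.integral_sum)
  finally have "real (n div 2) * (\<beta> * core_mass * ((2 - 2 powr \<alpha>) / 4) * r powr \<alpha>) - C
    \<le> (\<integral>p. (\<Sum>i\<in>J. a * indicator (?E i) p - b * indicator (?M i) p) \<partial>sample n) - C" by simp
  also have "\<dots> = (\<integral>p. (\<Sum>i\<in>J. a * indicator (?E i) p - b * indicator (?M i) p) - C \<partial>sample n)"
    using Bochner_Integration.integrable_sum[OF int, of J "\<lambda>i. i"]
    by (subst Bochner_Integration.integral_diff) (auto simp: prob_space)
  also have "\<dots> \<le> (\<integral>p. total_gain n \<delta> p \<partial>sample n)"
  proof (rule integral_mono)
    show "integrable (sample n) (\<lambda>p. (\<Sum>i\<in>J. a * indicator (?E i) p - b * indicator (?M i) p) - C)"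
      using Bochner_Integration.integrable_sum[OF int, of J "\<lambda>i. i"] by auto
    show "(\<Sum>i\<in>J. a * indicator (?E i) p - b * indicator (?M i) p) - C \<le> total_gain n \<delta> p"
      if p: "p \<in> space (sample n)" for p
      using C[OF p] p by (simp add: a_def b_def J_def indicator_def of_bool_def)
  qed (rule int_gain)
  finally show ?thesis .
qed

text \<open>
  With \<open>r\<close> and \<open>\<delta>\<close> of order \<open>n\<^sup>-\<^sup>1\<^sup>/\<^sup>2\<close> all probabilities are bounded below by constants, so the expected
  total gain is at least a constant times \<open>n \<cdot> r\<^sup>\<alpha>\<close>, which is of order \<open>n\<^sup>1\<^sup>-\<^sup>\<alpha>\<^sup>/\<^sup>2\<close>; the constant loss \<open>C\<close> is
  absorbed for large \<open>n\<close>.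
\<close>
lemma variance_TSP_sample:
  "\<exists>D>0. \<forall>\<^sub>F n in sequentially.
    D * real n powr (1 - \<alpha>) \<le> prob_space.variance (sample n) (\<lambda>p. TSP h \<alpha> p n)"
proof -
  obtain C where C: "\<forall>n r \<delta> p. 3 \<le> n \<longrightarrow> 0 < r \<longrightarrow> r \<le> 1 \<longrightarrow> \<delta> \<le> \<rho> \<longrightarrow> p \<in> space (sample n) \<longrightarrow>
    (\<Sum>i\<in>{1..n div 2}. (2 - 2 powr \<alpha>) * r powr \<alpha> * of_bool (movable n \<delta> i p \<and> far_from_sites n r i p)
      - 2 * \<delta> powr \<alpha> * of_bool (movable n \<delta> i p)) - C \<le> total_gain n \<delta> p"
    using total_gain_pointwise by (rule exE)
  define g where "g = 2 - 2 powr \<alpha>"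
  \<comment> \<open>Chosen so that the insertion cost \<open>2 (\<kappa> r)\<^sup>\<alpha>\<close> is exactly a quarter of the gain \<open>g r\<^sup>\<alpha>\<close>.\<close>
  define \<kappa> where "\<kappa> = (g / 8) powr (1 / \<alpha>)"
  define d where "d = core_mass"
  \<comment> \<open>The third entry makes \<open>n\<close> discs of radius \<open>r\<^sub>0 / sqrt n\<close> take at most half the mass of the core.\<close>
  define r\<^sub>0 where "r\<^sub>0 = min 1 (min \<rho> (sqrt (d / (2 * \<epsilon>\<^sub>2 * pi))))"
  have d: "0 < d" "d \<le> 1" using core_mass_pos core_mass_le_1 by (simp_all add: d_def)
  have g: "0 < g" "g \<le> 1"
    using two_powr_less_two[of \<alpha>] pos ge_one_powr_ge_zero[of 2 \<alpha>] by (simp_all add: g_def)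
  have \<kappa>: "0 < \<kappa>" "\<kappa> \<le> 1" "\<kappa> powr \<alpha> = g / 8"
    using g pos powr_mono2[of "1 / \<alpha>" "g / 8" 1] by (simp_all add: \<kappa>_def powr_powr)
  have sq0: "0 < d / (2 * \<epsilon>\<^sub>2 * pi)" using d eps_pos by simp
  then have r0: "0 < r\<^sub>0" "r\<^sub>0 \<le> 1" "r\<^sub>0 \<le> \<rho>" using pos by (simp_all add: r\<^sub>0_def)
  have r0_sq: "\<epsilon>\<^sub>2 * pi * r\<^sub>0\<^sup>2 \<le> d / 2"
  proof -
    have "r\<^sub>0\<^sup>2 \<le> (sqrt (d / (2 * \<epsilon>\<^sub>2 * pi)))\<^sup>2" using r0 by (intro power_mono) (auto simp: r\<^sub>0_def)
    then have "r\<^sub>0\<^sup>2 \<le> d / (2 * \<epsilon>\<^sub>2 * pi)" using sq0 by simp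
    then show ?thesis using eps_pos by (simp add: field_simps)
  qed
  define \<beta> where "\<beta> = \<epsilon>\<^sub>1 * pi * \<kappa>\<^sup>2 * r\<^sub>0\<^sup>2 * d / 4"
  define c\<^sub>3 where "c\<^sub>3 = \<beta> * d * (g / 4) * r\<^sub>0 powr \<alpha> / 3"
  have \<beta>: "0 < \<beta>" using eps_pos \<kappa> r0 d by (simp add: \<beta>_def)
  have c3: "0 < c\<^sub>3" using \<beta> d g r0 by (simp add: c\<^sub>3_def)
  have main: "(c\<^sub>3 / 2)\<^sup>2 * real n powr (1 - \<alpha>) \<le> prob_space.variance (sample n) (\<lambda>p. TSP h \<alpha> p n)"
    if n: "3 \<le> n" and large: "C \<le> c\<^sub>3 / 2 * real n powr (1 - \<alpha> / 2)" for n
  proof -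
    have n0: "0 < real n" "1 \<le> sqrt (real n)" using n by auto
    define r where "r = r\<^sub>0 / sqrt (real n)"
    define \<delta> where "\<delta> = \<kappa> * r"
    have r: "0 < r" "r \<le> r\<^sub>0" using r0 n0 by (simp_all add: r_def divide_le_eq)
    have r_sq: "r\<^sup>2 = r\<^sub>0\<^sup>2 / n" using n0 by (simp add: r_def power_divide)
    have nr: "real n * (\<epsilon>\<^sub>2 * pi * r\<^sup>2) \<le> d / 2" using r0_sq n0 by (simp add: r_sq)
    have \<delta>: "0 < \<delta>" "\<delta> \<le> r" using \<kappa> r by (simp_all add: \<delta>_def)
    have n\<delta>: "real n * (\<epsilon>\<^sub>2 * pi * \<delta>\<^sup>2) \<le> 1 / 2"
    proof -
      have "\<delta>\<^sup>2 \<le> r\<^sup>2" using \<delta> by (intro power_mono) auto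
      then have "real n * (\<epsilon>\<^sub>2 * pi * \<delta>\<^sup>2) \<le> real n * (\<epsilon>\<^sub>2 * pi * r\<^sup>2)"
        using eps_pos by (intro mult_left_mono) auto
      then show ?thesis using nr d by linarith
    qed
    have ready: "\<beta> \<le> measure (sample n) {p \<in> space (sample n). copy_ready n \<delta> i p}"
      if i: "i \<in> {1..n div 2}" for i
    proof -
      have "\<beta> = real n / 2 * (\<epsilon>\<^sub>1 * pi * \<delta>\<^sup>2 * d) / 2"
        using n0 by (simp add: \<beta>_def \<delta>_def power_mult_distrib r_sq)
      also have "\<dots> \<le> real (n - n div 2) * (\<epsilon>\<^sub>1 * pi * \<delta>\<^sup>2 * d) / 2"
        using eps_pos d by (intro divide_right_mono mult_right_mono) auto
      also have "\<dots> \<le> measure (sample n) {p \<in> space (sample n). copy_ready n \<delta> i p}"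
        unfolding d_def using \<delta> r r0 by (intro prob_copy_ready_ge i n\<delta>) auto
      finally show ?thesis .
    qed
    have \<delta>_small: "2 * \<delta> powr \<alpha> \<le> g / 4 * r powr \<alpha>"
      using \<kappa> r by (simp add: \<delta>_def powr_mult)
    have r_powr: "r powr \<alpha> = r\<^sub>0 powr \<alpha> * real n powr (- \<alpha> / 2)"
      using r0 n0 by (simp add: r_def powr_divide powr_half_sqrt[symmetric] powr_powr powr_minus_divide)
    have "c\<^sub>3 * real n powr (1 - \<alpha> / 2) = real n / 3 * (\<beta> * d * (g / 4) * r powr \<alpha>)"
      using n0 powr_add[of "real n" 1 "- \<alpha> / 2"] by (simp add: c\<^sub>3_def r_powr)
    also have "\<dots> \<le> real (n div 2) * (\<beta> * d * (g / 4) * r powr \<alpha>)"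
    proof (intro mult_right_mono)
      have "n \<le> 3 * (n div 2)" using n by presburger
      then show "real n / 3 \<le> real (n div 2)" by linarith
    qed (use \<beta> d g in auto)
    finally have "c\<^sub>3 * real n powr (1 - \<alpha> / 2) - C \<le> real (n div 2) * (\<beta> * d * (g / 4) * r powr \<alpha>) - C"
      by simp
    also have "\<dots> \<le> (\<integral>p. total_gain n \<delta> p \<partial>sample n)"
      unfolding d_def g_def
    proof (rule expected_total_gain_ge)
      show "(\<Sum>i\<in>{1..n div 2}. (2 - 2 powr \<alpha>) * r powr \<alpha> * of_bool (movable n \<delta> i p \<and> far_from_sites n r i p)
        - 2 * \<delta> powr \<alpha> * of_bool (movable n \<delta> i p)) - C \<le> total_gain n \<delta> p"
        if "p \<in> space (sample n)" for p
        using C[rule_format, OF n r(1) _ _ that, of \<delta>] r r0 \<delta> by simp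
    qed (use n r nr \<delta>_small \<beta> ready in \<open>auto simp: d_def g_def\<close>)
    finally have gain: "c\<^sub>3 / 2 * real n powr (1 - \<alpha> / 2) \<le> (\<integral>p. total_gain n \<delta> p \<partial>sample n)"
      using large by simp
    \<comment> \<open>Now \<open>t = L / n\<close> in \<open>variance_lower_bound\<close>, a choice of the optimal order, as \<open>G\<close> has second moment of order \<open>n\<close>.\<close>
    define L where "L = c\<^sub>3 / 2 * real n powr (1 - \<alpha> / 2)"
    have L: "0 \<le> L" using c3 by (simp add: L_def)
    have "2 * (L / n) * L - (L / n)\<^sup>2 * real (n div 2) \<le> prob_space.variance (sample n) (\<lambda>p. TSP h \<alpha> p n)"
      by (rule variance_lower_bound[where \<delta> = \<delta> and B = "real n * (2 * c\<^sub>2) powr \<alpha>"])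
        (use TSP_measurable TSP_bounds[OF n] gain L in \<open>auto simp: L_def total_gain_def\<close>)
    moreover have "(L / n)\<^sup>2 * real (n div 2) \<le> (L / n)\<^sup>2 * n" by (intro mult_left_mono) auto
    moreover have "(L / n)\<^sup>2 * n = L\<^sup>2 / n" using n0 by (simp add: power2_eq_square)
    moreover have "2 * (L / n) * L = 2 * (L\<^sup>2 / n)" by (simp add: power2_eq_square)
    moreover have "L\<^sup>2 / n = (c\<^sub>3 / 2)\<^sup>2 * real n powr (1 - \<alpha>)"
    proof -
      have "(real n powr (1 - \<alpha> / 2))\<^sup>2 = real n powr (1 - \<alpha>) * real n"
        using n0 powr_add[of "real n" "1 - \<alpha>" 1]
        by (simp add: power2_eq_square powr_add[symmetric])
      moreover have "L\<^sup>2 = (c\<^sub>3 / 2)\<^sup>2 * (real n powr (1 - \<alpha> / 2))\<^sup>2"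
        unfolding L_def by (rule power_mult_distrib)
      ultimately show ?thesis using n0 by simp
    qed
    ultimately show ?thesis by linarith
  qed
  have "filterlim (\<lambda>n. c\<^sub>3 / 2 * exp ((1 - \<alpha> / 2) * ln (real n))) at_top sequentially"
    using c3 pos
    by (intro filterlim_tendsto_pos_mult_at_top[OF tendsto_const] filterlim_compose[OF exp_at_top]
        filterlim_compose[OF ln_at_top filterlim_real_sequentially]) auto
  then have "\<forall>\<^sub>F n in sequentially. C \<le> c\<^sub>3 / 2 * exp ((1 - \<alpha> / 2) * ln (real n))"
    by (simp add: filterlim_at_top)
  then have "\<forall>\<^sub>F n in sequentially. C \<le> c\<^sub>3 / 2 * real n powr (1 - \<alpha> / 2)"
    using eventually_gt_at_top[of 0] by eventually_elim (simp add: powr_def)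
  then have "\<forall>\<^sub>F n in sequentially.
      (c\<^sub>3 / 2)\<^sup>2 * real n powr (1 - \<alpha>) \<le> prob_space.variance (sample n) (\<lambda>p. TSP h \<alpha> p n)"
    using eventually_ge_at_top[of 3] by eventually_elim (rule main)
  then show ?thesis using c3 by (intro exI[of _ "(c\<^sub>3 / 2)\<^sup>2"]) simp
qed

end

section \<open>Squares, densities and the variance of the shortest tour\<close>

text \<open>
  The matrix with columns \<open>u\<close> and \<open>v\<close> is orthogonal, so its rows are orthonormal too. To see this,
  \<open>v\<close> is \<open>u\<close> turned by a right angle, up to the sign \<open>D\<close> of the determinant.
\<close>
lemma orthonormal_pair_expansion:
  fixes u v w :: "real^2"
  assumes "norm u = 1" "norm v = 1" "u \<bullet> v = 0"
  shows "w = (w \<bullet> u) *\<^sub>R u + (w \<bullet> v) *\<^sub>R v"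
proof -
  define u1 u2 v1 v2 where "u1 = u $ 1" "u2 = u $ 2" "v1 = v $ 1" "v2 = v $ 2"
  note d = u1_u2_v1_v2_def
  have "u \<bullet> u = 1" "v \<bullet> v = 1" using assms by (simp_all add: dot_square_norm)
  then have e: "u1 * u1 + u2 * u2 = 1" "v1 * v1 + v2 * v2 = 1" "u1 * v1 + u2 * v2 = 0"
    using assms(3) by (simp_all add: inner_vec_def sum_2 d)
  define D where "D = u1 * v2 - u2 * v1"
  have v: "v1 = - u2 * D" "v2 = u1 * D" using e unfolding D_def by algebra+
  have "D * D = 1" using e unfolding D_def by algebra
  then have "u1 * u1 + v1 * v1 = 1" "u2 * u2 + v2 * v2 = 1" "u1 * u2 + v1 * v2 = 0"
    using e unfolding v by algebra+
  then have "x * 1 = (x * u1 + y * u2) * u1 + (x * v1 + y * v2) * v1"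
    "y = (x * u1 + y * u2) * u2 + (x * v1 + y * v2) * v2" for x y
    by algebra+
  then show ?thesis by (simp add: vec_eq_iff forall_2 inner_vec_def sum_2 d)
qed

text \<open>
  Around the centre of the square, because the coordinates of \<open>z - c\<close> along \<open>u\<close> and \<open>v\<close> are at most
  its norm.
\<close>
lemma square_contains_ball:
  assumes "is_square T s"
  obtains c where "ball c (s / 2) \<subseteq> T"
proof -
  obtain a u v where uv: "norm u = 1" "norm v = 1" "u \<bullet> v = 0"
    and T: "T = {a + x *\<^sub>R u + y *\<^sub>R v |x y. x \<in> {0..s} \<and> y \<in> {0..s}}"
    using assms unfolding is_square_def by blast
  define c where "c = a + (s / 2) *\<^sub>R u + (s / 2) *\<^sub>R v"
  have "ball c (s / 2) \<subseteq> T"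
  proof
    fix z assume z: "z \<in> ball c (s / 2)"
    define x y where "x = (z - c) \<bullet> u" "y = (z - c) \<bullet> v"
    have "norm (z - c) < s / 2" using z by (simp add: dist_norm norm_minus_commute)
    moreover have "\<bar>x\<bar> \<le> norm (z - c)" "\<bar>y\<bar> \<le> norm (z - c)"
      using Cauchy_Schwarz_ineq2[of "z - c" u] Cauchy_Schwarz_ineq2[of "z - c" v] uv
      by (simp_all add: x_y_def)
    ultimately have "s / 2 + x \<in> {0..s}" "s / 2 + y \<in> {0..s}" by auto
    moreover have "z = a + (s / 2 + x) *\<^sub>R u + (s / 2 + y) *\<^sub>R v"
    proof -
      have "z - c = x *\<^sub>R u + y *\<^sub>R v"
        unfolding x_y_def by (rule orthonormal_pair_expansion[OF uv])
      then have "z = c + (x *\<^sub>R u + y *\<^sub>R v)" by (metis add.commute diff_add_cancel)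
      then show ?thesis by (simp add: c_def algebra_simps)
    qed
    ultimately show "z \<in> T" unfolding T by blast
  qed
  then show ?thesis by (rule that)
qed

lemma measure_density_bounds:
  fixes f :: "real^2 \<Rightarrow> real" and S :: "(real^2) set"
  defines "\<mu> \<equiv> density (restrict_space lborel S) (\<lambda>x. ennreal (f x))"
  assumes S: "S \<in> sets borel" and f: "(\<lambda>x. ennreal (f x)) \<in> borel_measurable (restrict_space lborel S)"
    and bd: "\<And>x. x \<in> S \<Longrightarrow> \<epsilon>\<^sub>1 \<le> f x \<and> f x \<le> \<epsilon>\<^sub>2" and "0 < \<epsilon>\<^sub>1"
    and "prob_space \<mu>" and A: "A \<in> sets borel" "A \<subseteq> S" and fin: "emeasure lborel A < \<infinity>"
  shows "\<epsilon>\<^sub>1 * measure lborel A \<le> measure \<mu> A" "measure \<mu> A \<le> \<epsilon>\<^sub>2 * measure lborel A"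
proof -
  interpret prob_space \<mu> by fact
  let ?R = "restrict_space lborel S"
  have AR: "A \<in> sets ?R" using A S by (auto simp: sets_restrict_space)
  have vol: "emeasure ?R A = ennreal (measure lborel A)"
  proof -
    have "emeasure ?R A = emeasure lborel A" using A S by (intro emeasure_restrict_space) auto
    also have "\<dots> = ennreal (measure lborel A)" using fin by (intro emeasure_eq_ennreal_measure) auto
    finally show ?thesis .
  qed
  have \<mu>A: "emeasure \<mu> A = (\<integral>\<^sup>+ x. ennreal (f x) * indicator A x \<partial>?R)"
    unfolding \<mu>_def by (rule emeasure_density[OF f AR])
  have space_R: "x \<in> S" if "x \<in> space ?R" for x using that by (simp add: space_restrict_space)
  have e2: "S \<noteq> {} \<Longrightarrow> 0 \<le> \<epsilon>\<^sub>2" using bd \<open>0 < \<epsilon>\<^sub>1\<close> by force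
  have "ennreal \<epsilon>\<^sub>1 * emeasure ?R A = (\<integral>\<^sup>+ x. ennreal \<epsilon>\<^sub>1 * indicator A x \<partial>?R)"
    using AR by (simp add: nn_integral_cmult_indicator)
  also have "\<dots> \<le> emeasure \<mu> A" unfolding \<mu>A
    by (intro nn_integral_mono mult_right_mono ennreal_leI) (use bd space_R in auto)
  finally have "ennreal (\<epsilon>\<^sub>1 * measure lborel A) \<le> ennreal (measure \<mu> A)"
    using \<open>0 < \<epsilon>\<^sub>1\<close> by (simp add: vol emeasure_eq_measure ennreal_mult)
  then show "\<epsilon>\<^sub>1 * measure lborel A \<le> measure \<mu> A" by simp
  have "emeasure \<mu> A \<le> (\<integral>\<^sup>+ x. ennreal \<epsilon>\<^sub>2 * indicator A x \<partial>?R)" unfolding \<mu>A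
    by (intro nn_integral_mono mult_right_mono ennreal_leI) (use bd space_R in auto)
  also have "\<dots> = ennreal \<epsilon>\<^sub>2 * emeasure ?R A"
    using AR by (simp add: nn_integral_cmult_indicator)
  finally have le: "ennreal (measure \<mu> A) \<le> ennreal \<epsilon>\<^sub>2 * ennreal (measure lborel A)"
    by (simp add: vol emeasure_eq_measure)
  have "S \<noteq> {}" using not_empty by (auto simp: \<mu>_def space_restrict_space)
  then have "0 \<le> \<epsilon>\<^sub>2" by (rule e2)
  with le show "measure \<mu> A \<le> \<epsilon>\<^sub>2 * measure lborel A" by (simp add: ennreal_mult[symmetric])
qed

theorem theorem5:
  fixes M :: "'a measure"
    and X :: "nat \<Rightarrow> 'a \<Rightarrow> real^2"
    and f :: "real^2 \<Rightarrow> real"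
    and h :: "real^2 \<Rightarrow> real^2 \<Rightarrow> real"
    and S\<^sub>0 :: "(real^2) set"
    and \<epsilon>\<^sub>1 \<epsilon>\<^sub>2 c\<^sub>1 c\<^sub>2 s\<^sub>0 \<alpha> :: real
  assumes "prob_space M"
    and "0 < \<epsilon>\<^sub>1" and "\<epsilon>\<^sub>1 \<le> \<epsilon>\<^sub>2"
    and "\<And>x. x \<in> unit_square \<Longrightarrow> \<epsilon>\<^sub>1 \<le> f x \<and> f x \<le> \<epsilon>\<^sub>2"
    and "\<And>i. 1 \<le> i \<Longrightarrow> distributed M (restrict_space lborel unit_square) (X i) (\<lambda>x. ennreal (f x))"
    and "prob_space.indep_vars M (\<lambda>_. restrict_space borel unit_square) X {1..}"
    and "0 < c\<^sub>1" and "0 < c\<^sub>2"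
    and "(\<lambda>(x, y). h x y) \<in> borel_measurable (restrict_space borel (unit_square \<times> unit_square))"
    and "\<And>x y. x \<in> unit_square \<Longrightarrow> y \<in> unit_square \<Longrightarrow> h x y = h y x"
    and "\<And>x y. x \<in> unit_square \<Longrightarrow> y \<in> unit_square \<Longrightarrow> c\<^sub>1 * dist x y \<le> h x y \<and> h x y \<le> c\<^sub>2 * dist x y"
    and "is_square S\<^sub>0 s\<^sub>0" and "S\<^sub>0 \<subseteq> unit_square"
    and "\<And>u v. u \<in> unit_square \<Longrightarrow> v \<in> unit_square \<Longrightarrow> u \<in> S\<^sub>0 \<or> v \<in> S\<^sub>0 \<Longrightarrow> h u v = dist u v"
    and "0 < \<alpha>" and "\<alpha> < 1"
  shows "\<exists>D\<^sub>2>0. \<forall>\<^sub>F n in sequentially.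
           prob_space.variance M (\<lambda>\<omega>. TSP h \<alpha> (\<lambda>i. X i \<omega>) n) \<ge> D\<^sub>2 * real n powr (1 - \<alpha>)"
proof -
  interpret M: prob_space M by fact
  define R where "R = restrict_space (lborel :: (real^2) measure) unit_square"
  define Q where "Q = restrict_space (borel :: (real^2) measure) unit_square"
  define \<mu> where "\<mu> = density R (\<lambda>x. ennreal (f x))"
  have sets_RQ: "sets R = sets Q"
    unfolding R_def Q_def by (intro sets_restrict_space_cong) simp
  have X_meas: "X i \<in> measurable M Q" if "1 \<le> i" for i
    using distributed_measurable[OF assms(5)[OF that]] measurable_cong_sets[OF refl sets_RQ]
    unfolding R_def by blast
  have distr_X: "distr M Q (X i) = \<mu>" if "1 \<le> i" for i
    using distributed_distr_eq_density[OF assms(5)[OF that]]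
    by (simp add: \<mu>_def R_def[symmetric] distr_cong[OF refl sets_RQ])
  have mu_prob: "prob_space \<mu>"
    using M.prob_space_distr[OF X_meas[of 1]] distr_X[of 1] by simp
  have unit_borel: "unit_square \<in> sets borel" by (simp add: unit_square_def)
  have f_meas: "(\<lambda>x. ennreal (f x)) \<in> borel_measurable (restrict_space lborel unit_square)"
    using distributed_borel_measurable[OF assms(5)[of 1]] by simp
  obtain c where c: "ball c (s\<^sub>0 / 2) \<subseteq> S\<^sub>0"
    using square_contains_ball assms(12) by blast
  define \<rho> where "\<rho> = s\<^sub>0 / 4"
  have s0: "0 < s\<^sub>0" using assms(12) by (simp add: is_square_def)
  have ball_S0: "ball c (2 * \<rho>) \<subseteq> S\<^sub>0" using c by (simp add: \<rho>_def)
  have area: "measure lborel (ball x r) = pi * r\<^sup>2" if "0 < r" for x :: "real^2" and r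
    using content_ball[of r x] that by (simp add: unit_ball_vol_2)
  have dens: "\<epsilon>\<^sub>1 * measure lborel A \<le> measure \<mu> A" "measure \<mu> A \<le> \<epsilon>\<^sub>2 * measure lborel A"
    if "A \<in> sets borel" "A \<subseteq> unit_square" "emeasure lborel A < \<infinity>" for A
    using measure_density_bounds[of unit_square f \<epsilon>\<^sub>1 \<epsilon>\<^sub>2 A] unit_borel f_meas mu_prob that assms(2,4)
    by (simp_all add: \<mu>_def R_def)

  interpret tsp_sample h c\<^sub>1 c\<^sub>2 \<rho> \<alpha> c \<mu> \<epsilon>\<^sub>1 \<epsilon>\<^sub>2
  proof (intro tsp_sample.intro locally_euclidean_weight.intro tsp_sample_axioms.intro)
    show "ball c (2 * \<rho>) \<subseteq> unit_square" using ball_S0 assms(13) by blast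
    show "h u v = dist u v" if "u \<in> unit_square" "v \<in> unit_square"
      "u \<in> ball c (2 * \<rho>) \<or> v \<in> ball c (2 * \<rho>)" for u v
      using assms(14) that ball_S0 by blast
    show "sets \<mu> = sets (restrict_space borel unit_square)"
      using sets_RQ by (simp add: \<mu>_def Q_def)
    show "measure \<mu> {y \<in> unit_square. dist x y < r} \<le> \<epsilon>\<^sub>2 * pi * r\<^sup>2" if "0 < r" for x r
    proof -
      have eq: "{y \<in> unit_square. dist x y < r} = unit_square \<inter> ball x r" by auto
      have le: "emeasure lborel (unit_square \<inter> ball x r) \<le> emeasure lborel (ball x r)"
        by (intro emeasure_mono) auto
      have fin: "emeasure lborel (ball x r) < \<infinity>"
        by (rule emeasure_bounded_finite[OF bounded_ball])
      have "measure \<mu> (unit_square \<inter> ball x r) \<le> \<epsilon>\<^sub>2 * measure lborel (unit_square \<inter> ball x r)"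
        by (rule dens(2)[OF _ _ le_less_trans[OF le fin]]) (use unit_borel in auto)
      also have "\<dots> \<le> \<epsilon>\<^sub>2 * measure lborel (ball x r)"
        using fin assms(2,3) unit_borel
        by (intro mult_left_mono measure_mono_fmeasurable) (auto simp: fmeasurable_def)
      finally show ?thesis using area[OF that] eq by (simp add: mult.assoc)
    qed
    show "\<epsilon>\<^sub>1 * pi * r\<^sup>2 \<le> measure \<mu> {y \<in> unit_square. dist x y < r}"
      if "ball x r \<subseteq> unit_square" "0 < r" for x r
    proof -
      have eq: "{y \<in> unit_square. dist x y < r} = ball x r" using that by auto
      have "\<epsilon>\<^sub>1 * measure lborel (ball x r) \<le> measure \<mu> (ball x r)"
        by (rule dens(1)[OF _ that(1) emeasure_bounded_finite[OF bounded_ball]]) simp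
      then show ?thesis using area[OF that(2)] eq by (simp add: mult.assoc)
    qed
    show "h x y = h y x" if "x \<in> unit_square" "y \<in> unit_square" for x y
      by (rule assms(10)[OF that])
    show "c\<^sub>1 * dist x y \<le> h x y \<and> h x y \<le> c\<^sub>2 * dist x y"
      if "x \<in> unit_square" "y \<in> unit_square" for x y
      by (rule assms(11)[OF that])
  qed (use assms(2,3,7,8,9,15,16) mu_prob s0 in \<open>simp_all add: \<rho>_def\<close>)

  have transfer: "M.variance (\<lambda>\<omega>. TSP h \<alpha> (\<lambda>i. X i \<omega>) n) = prob_space.variance (sample n) (\<lambda>p. TSP h \<alpha> p n)"
    if n: "1 \<le> n" for n
  proof -
    define I where "I = {1..2 * n}"
    define Y where "Y \<omega> = (\<lambda>i\<in>I. X i \<omega>)" for \<omega>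
    have I: "I \<noteq> {}" "\<And>i. i \<in> I \<Longrightarrow> 1 \<le> i" using n by (auto simp: I_def)
    have "M.indep_vars (\<lambda>_. Q) X I"
      using M.indep_vars_subset[OF assms(6), of I] by (auto simp: Q_def I_def)
    then have "distr M (PiM I (\<lambda>_. Q)) Y = PiM I (\<lambda>i. distr M Q (X i))"
      using M.indep_vars_iff_distr_eq_PiM'[OF I(1), where M' = "\<lambda>_. Q" and X = X] X_meas I(2) by (simp add: Y_def[abs_def])
    also have "\<dots> = sample n"
      unfolding sample_def I_def by (rule PiM_cong) (use distr_X in auto)
    finally have distr: "distr M (PiM I (\<lambda>_. Q)) Y = sample n" .
    have Y_meas: "Y \<in> measurable M (PiM I (\<lambda>_. Q))"
      unfolding Y_def[abs_def] by (rule measurable_restrict) (use X_meas I in auto)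
    have TSP_Y: "TSP h \<alpha> (Y \<omega>) n = TSP h \<alpha> (\<lambda>i. X i \<omega>) n" for \<omega>
      by (rule TSP_cong) (auto simp: Y_def I_def)
    have int: "(\<integral>p. H p \<partial>sample n) = (\<integral>\<omega>. H (Y \<omega>) \<partial>M)"
      if "H \<in> borel_measurable (sample n)" for H :: "_ \<Rightarrow> real"
      using that Y_meas unfolding distr[symmetric] by (intro integral_distr) simp_all
    show ?thesis
      using TSP_measurable[of n] by (simp add: int TSP_Y)
  qed
  obtain D where D: "0 < D" "\<forall>\<^sub>F n in sequentially.
      D * real n powr (1 - \<alpha>) \<le> prob_space.variance (sample n) (\<lambda>p. TSP h \<alpha> p n)"
    using variance_TSP_sample by blast
  have "\<forall>\<^sub>F n in sequentially. M.variance (\<lambda>\<omega>. TSP h \<alpha> (\<lambda>i. X i \<omega>) n) \<ge> D * real n powr (1 - \<alpha>)"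
    using D(2) eventually_ge_at_top[of 1] by eventually_elim (simp add: transfer)
  with D(1) show ?thesis by blast
qed

end
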